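(* The following hold: (i) There exists a constant $C$ such that for any $f$ in $BMO_2$ the functional $\ell$ defined on $H^{1,2}_{\mathrm{fin}}$ by $\ell(g)=\int f\,g\,d\rho$ for all $g\in H^{1,2}_{\mathrm{fin}}$ extends to a bounded linear functional on $H^{1,2}$, and $\|\ell\|_{(H^{1,2})^*}\leq C\,\|f\|_{2,*}$. (ii) There exists a constant $C$ such that for any bounded linear functional $\ell$ on $H^{1,2}$ there exists a function $f^{\ell}$ in $BMO_2$ such that $\|f^{\ell}\|_{2,*}\leq C\,\|\ell\|_{(H^{1,2})^*}$ and $\ell(g)=\int f^{\ell}\,g\,d\rho$ for any $g$ in $H^{1,2}_{\mathrm{fin}}$.
   Context: Let $d\geq 1$ be an integer and $S=\mathbb{R}^d\ltimes\mathbb{R}^+$ the group with product $(x,a)\cdot(x',a')=(x+a\,x',a\,a')$, endowed with the right Haar measure $d\rho(x,a)=a^{-1}\,dx\,da$. Write $L^p=L^p(S,\rho)$ with norm $\|\cdot\|_p$. A Calderón--Zygmund set is a set $R=Q\times[ae^{-r},ae^r]$, where $Q$ is a dyadic cube in $\mathbb{R}^d$ of side $L$, $a\in\mathbb{R}^+$, $r>0$, and $e^2ar\leq L<e^8ar$ if $r<1$, while $ae^{2r}\leq L<ae^{8r}$ if $r\geq1$. $\mathcal{R}$ denotes the family of all Calderón--Zygmund sets. A $(1,2)$-atom is a function $a$ supported in a Calderón--Zygmund set $R$ such that $\|a\|_2\leq\rho(R)^{-1/2}$ and $\int a\,d\rho=0$. The space $H^{1,2}$ consists of all $h\in L^1$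 such that $h=\sum_j\lambda_ja_j$ with $a_j$ $(1,2)$-atoms and $\lambda_j$ complex numbers with $\sum_j|\lambda_j|<\infty$; $\|h\|_{H^{1,2}}$ is the infimum of $\sum_j|\lambda_j|$ over all such decompositions. $H^{1,2}_{\mathrm{fin}}$ is the (dense) vector subspace of finite linear combinations of $(1,2)$-atoms, and $(H^{1,2})^*$ is the Banach dual of $H^{1,2}$. For $f\in L^2_{\mathrm{loc}}$ and $R\in\mathcal{R}$ let $f_R=\frac{1}{\rho(R)}\int_Rf\,d\rho$, $\|f\|_{2,*}=\sup_{R\in\mathcal{R}}\big(\frac{1}{\rho(R)}\int_R|f-f_R|^2\,d\rho\big)^{1/2}$, and $BMO_2=\{f\in L^2_{\mathrm{loc}}:\|f\|_{2,*}<\infty\}$. *)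

theory Defs
  imports "HOL-Analysis.Analysis"
begin

text \<open>
  The group \<open>\<real>\<^sup>d \<ltimes> \<real>\<^sup>+\<close>, with product \<open>(x, a) (x', a') = (x + a x', a a')\<close>, is the half-space of
  pairs \<open>(x, a)\<close> with \<open>a > 0\<close> in the type \<open>(real ^ 'n) \<times> real\<close>, where \<open>d = CARD('n) \<ge> 1\<close>. The product
  enters the spaces below only through the right Haar measure \<open>a\<^sup>-\<^sup>1 dx da\<close>.
\<close>

definition AxB :: "((real ^ 'n) \<times> real) set" where
  "AxB = UNIV \<times> {0<..}"

definition rho :: "((real ^ 'n) \<times> real) measure" where
  "rho = density (restrict_space lborel AxB) (\<lambda>(x, a). ennreal (1 / a))"

text \<open>
  Elements of function spaces are represented by (complex valued, measurable) functions rather than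
  by classes modulo \<open>rho\<close>-null sets. All notions below are invariant under changes on null sets;
  the values at points outside \<open>AxB\<close> are irrelevant.
\<close>

definition L2_norm :: "((real ^ 'n) \<times> real \<Rightarrow> complex) \<Rightarrow> real" where
  "L2_norm f = sqrt (LINT z|rho. (cmod (f z))\<^sup>2)"

definition L2 :: "((real ^ 'n) \<times> real \<Rightarrow> complex) set" where
  "L2 = {f \<in> borel_measurable rho. integrable rho (\<lambda>z. (cmod (f z))\<^sup>2)}"

definition L2_loc :: "((real ^ 'n) \<times> real \<Rightarrow> complex) set" where
  "L2_loc = {f \<in> borel_measurable rho.
     \<forall>K. compact K \<and> K \<subseteq> AxB \<longrightarrow> set_integrable rho K (\<lambda>z. (cmod (f z))\<^sup>2)}"

text \<open>The dyadic cube with side \<open>2\<^sup>k\<close> and lower corner \<open>2\<^sup>k m\<close>; half-open, so that the cubes of a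
  given side partition the space.\<close>

definition dyadic_cube :: "int \<Rightarrow> int ^ 'n \<Rightarrow> (real ^ 'n) set" where
  "dyadic_cube k m =
     {x. \<forall>i. of_int (m $ i) * 2 powi k \<le> x $ i \<and> x $ i < (of_int (m $ i) + 1) * 2 powi k}"

definition CZ_sets :: "((real ^ 'n) \<times> real) set set" where
  "CZ_sets = {dyadic_cube k m \<times> {a * exp (- r)..a * exp r} | k m a r.
     0 < a \<and> 0 < r \<and>
     (if r < 1 then exp 2 * a * r \<le> 2 powi k \<and> 2 powi k < exp 8 * a * r
      else a * exp (2 * r) \<le> 2 powi k \<and> 2 powi k < a * exp (8 * r))}"

text \<open>Calderon--Zygmund sets have finite measure, so an \<open>L\<^sup>2\<close> function supported in one of them is
  integrable and the cancellation condition is meaningful. Supports are understood up to null sets.\<close>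

definition atom :: "((real ^ 'n) \<times> real \<Rightarrow> complex) \<Rightarrow> bool" where
  "atom b \<longleftrightarrow> b \<in> L2 \<and>
     (\<exists>R\<in>CZ_sets. (AE z in rho. z \<notin> R \<longrightarrow> b z = 0) \<and>
        L2_norm b \<le> measure rho R powr (- 1 / 2)) \<and>
     (LINT z|rho. b z) = 0"

text \<open>\<open>h = (\<Sum>j. c j * b j)\<close> with convergence in \<open>L\<^sup>1\<close>.\<close>

definition atomic_decomposition ::
  "((real ^ 'n) \<times> real \<Rightarrow> complex) \<Rightarrow> (nat \<Rightarrow> complex) \<Rightarrow> (nat \<Rightarrow> (real ^ 'n) \<times> real \<Rightarrow> complex) \<Rightarrow> bool" where
  "atomic_decomposition h c b \<longleftrightarrow>
     (\<forall>j. atom (b j)) \<and> summable (\<lambda>j. cmod (c j)) \<and>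
     (\<lambda>N. LINT z|rho. cmod (h z - (\<Sum>j<N. c j * b j z))) \<longlonglongrightarrow> 0"

definition H12 :: "((real ^ 'n) \<times> real \<Rightarrow> complex) set" where
  "H12 = {h. integrable rho h \<and> (\<exists>c b. atomic_decomposition h c b)}"

definition H12_norm :: "((real ^ 'n) \<times> real \<Rightarrow> complex) \<Rightarrow> real" where
  "H12_norm h = Inf {(\<Sum>j. cmod (c j)) | c b. atomic_decomposition h c b}"

definition H12_fin :: "((real ^ 'n) \<times> real \<Rightarrow> complex) set" where
  "H12_fin = {(\<lambda>z. \<Sum>j<N. c j * b j z) | (N :: nat) c b. \<forall>j<N. atom (b j)}"

text \<open>The Banach dual of \<open>H12\<close>. A functional is a function on all of
  \<open>(real ^ 'n) \<times> real \<Rightarrow> complex\<close> of which only the values on \<open>H12\<close> matter; the bound forces it to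
  respect equality almost everywhere, since \<open>H12_norm\<close> vanishes on null functions.\<close>

definition H12_dual :: "(((real ^ 'n) \<times> real \<Rightarrow> complex) \<Rightarrow> complex) set" where
  "H12_dual = {l.
     (\<forall>g\<in>H12. \<forall>h\<in>H12. l (\<lambda>z. g z + h z) = l g + l h) \<and>
     (\<forall>c. \<forall>g\<in>H12. l (\<lambda>z. c * g z) = c * l g) \<and>
     (\<exists>B. \<forall>g\<in>H12. cmod (l g) \<le> B * H12_norm g)}"

definition H12_dual_norm :: "(((real ^ 'n) \<times> real \<Rightarrow> complex) \<Rightarrow> complex) \<Rightarrow> real" where
  "H12_dual_norm l = (SUP g\<in>{g \<in> H12. H12_norm g \<le> 1}. cmod (l g))"

definition mean_value :: "((real ^ 'n) \<times> real \<Rightarrow> complex) \<Rightarrow> ((real ^ 'n) \<times> real) set \<Rightarrow> complex" where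
  "mean_value f R = (LINT z:R|rho. f z) / of_real (measure rho R)"

definition oscillation :: "((real ^ 'n) \<times> real \<Rightarrow> complex) \<Rightarrow> ((real ^ 'n) \<times> real) set \<Rightarrow> real" where
  "oscillation f R =
     sqrt ((LINT z:R|rho. (cmod (f z - mean_value f R))\<^sup>2) / measure rho R)"

definition BMO2_norm :: "((real ^ 'n) \<times> real \<Rightarrow> complex) \<Rightarrow> real" where
  "BMO2_norm f = (SUP R\<in>CZ_sets. oscillation f R)"

definition BMO2 :: "((real ^ 'n) \<times> real \<Rightarrow> complex) set" where
  "BMO2 = {f \<in> L2_loc. bdd_above (oscillation f ` CZ_sets)}"

end

theory Submission
  imports Defs
begin

text \<open>
  The easy half of the duality is the estimate \<open>\<bar>\<integral> f b d\<rho>\<bar> \<le> \<parallel>f\<parallel>\<^sub>*\<close> for an atom \<open>b\<close>: subtract from \<open>f\<close> its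
  mean over the supporting set \<open>R\<close>, which the cancellation of \<open>b\<close> permits, and use Cauchy--Schwarz.
  It does not by itself bound \<open>g \<mapsto> \<integral> f g d\<rho>\<close> by the norm of \<open>H12\<close>, because that norm is an infimum over
  infinite decompositions, along which an unbounded \<open>f\<close> cannot be integrated term by term. The remedy
  is to truncate. The nearest-point projection onto the disc of radius \<open>N\<close> is 1-Lipschitz, so the
  truncated function obeys the same estimate on atoms, with the oscillation of the original \<open>f\<close> on
  the right (\<open>atom_pairing_bound\<close>). Being bounded, it integrates against any \<open>L\<^sup>1\<close>-convergent
  decomposition (\<open>decomposition_pairing\<close>). The functional is therefore defined, independently of any
  decomposition, as the limit of the truncated pairings; Tannery's theorem gives its existence,
  and the bound by \<open>\<parallel>f\<parallel>\<^sub>*\<close> survives the limit (\<open>trunc_pairing_decomposition\<close>).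

  For the converse, a functional \<open>l\<close> on \<open>H12\<close> satisfies \<open>\<bar>l g\<bar> \<le> \<parallel>l\<parallel> \<rho>(R)\<^sup>1\<^sup>/\<^sup>2 \<parallel>g\<parallel>\<^sub>2\<close> for every square
  integrable \<open>g\<close> with mean zero supported in a Calderon--Zygmund set \<open>R\<close>, since such a \<open>g\<close> is a multiple
  of an atom. So \<open>l\<close> is represented locally, by the Riesz representation theorem on \<open>L\<^sup>2\<close>, but only up to an
  additive constant, and the local representers have to be made compatible. Dyadic cubes never cross
  a coordinate hyperplane, hence every Calderon--Zygmund set lies over one orthant; over each orthant
  there is an increasing exhausting sequence of Calderon--Zygmund sets, the towers. The additive constants are fixed
  once per orthant by means of a bump of integral one in the first tower: on the annulus between
  two consecutive towers one represents \<open>g \<mapsto> l (g - (\<integral> g d\<rho>) bump)\<close>, which is defined for all \<open>g\<close> in \<open>L\<^sup>2\<close> of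
  the annulus. The annuli partition the half-space, so these representers are glued without
  any compatibility condition. If \<open>g\<close> has mean zero and is supported in a tower, the
  bumps subtracted on the finitely many annuli cancel, and the glued function represents \<open>l\<close> on \<open>g\<close>
  (\<open>representer_tower\<close>). Testing \<open>l\<close> against the conjugate of \<open>f - f\<^sub>R\<close> on \<open>R\<close> bounds the
  oscillation of the representer \<open>f\<close> by \<open>\<parallel>l\<parallel>\<close>. Both implications hold with constant one.
\<close>

section \<open>Square integrable functions and the Riesz representation\<close>

definition sq_integrable :: "'a measure \<Rightarrow> ('a \<Rightarrow> 'b::euclidean_space) \<Rightarrow> bool" where
  "sq_integrable M f \<longleftrightarrow> f \<in> borel_measurable M \<and> integrable M (\<lambda>x. (norm (f x))\<^sup>2)"

lemma norm_add_sq_le: "(norm (a + b))\<^sup>2 \<le> 2 * (norm a)\<^sup>2 + 2 * (norm b)\<^sup>2"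
  for a b :: "'b::real_normed_vector"
proof -
  have "(norm (a + b))\<^sup>2 \<le> (norm a + norm b)\<^sup>2"
    by (intro power_mono norm_triangle_ineq norm_ge_zero)
  also have "\<dots> \<le> 2 * (norm a)\<^sup>2 + 2 * (norm b)\<^sup>2"
    using zero_le_power2[of "norm a - norm b"] by (simp add: power2_sum power2_diff)
  finally show ?thesis .
qed

lemma sq_integrable_bound:
  fixes f :: "'a \<Rightarrow> 'b::euclidean_space"
  assumes "sq_integrable M g" "f \<in> borel_measurable M" "AE x in M. norm (f x) \<le> norm (g x)"
  shows "sq_integrable M f"
  unfolding sq_integrable_def
proof
  show "integrable M (\<lambda>x. (norm (f x))\<^sup>2)"
  proof (rule Bochner_Integration.integrable_bound)
    show "integrable M (\<lambda>x. (norm (g x))\<^sup>2)" using assms(1) by (simp add: sq_integrable_def)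
    show "AE x in M. norm ((norm (f x))\<^sup>2) \<le> norm ((norm (g x))\<^sup>2)"
      using assms(3) by eventually_elim (simp add: power_mono)
  qed (use assms(2) in measurable)
qed fact

lemma sq_integrable_add:
  fixes f g :: "'a \<Rightarrow> 'b::euclidean_space"
  assumes "sq_integrable M f" "sq_integrable M g"
  shows "sq_integrable M (\<lambda>x. f x + g x)"
  unfolding sq_integrable_def
proof
  have [measurable]: "f \<in> borel_measurable M" "g \<in> borel_measurable M"
    using assms by (auto simp: sq_integrable_def)
  show "(\<lambda>x. f x + g x) \<in> borel_measurable M" by measurable
  show "integrable M (\<lambda>x. (norm (f x + g x))\<^sup>2)"
  proof (rule Bochner_Integration.integrable_bound)
    show "integrable M (\<lambda>x. 2 * (norm (f x))\<^sup>2 + 2 * (norm (g x))\<^sup>2)"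
      using assms by (auto simp: sq_integrable_def)
    show "AE x in M. norm ((norm (f x + g x))\<^sup>2) \<le> norm (2 * (norm (f x))\<^sup>2 + 2 * (norm (g x))\<^sup>2)"
      by (simp add: norm_add_sq_le)
  qed measurable
qed

lemma sq_integrable_scaleR:
  fixes f :: "'a \<Rightarrow> 'b::euclidean_space"
  assumes "sq_integrable M f"
  shows "sq_integrable M (\<lambda>x. c *\<^sub>R f x)"
  using assms by (auto simp: sq_integrable_def power_mult_distrib)

lemma sq_integrable_mult:
  fixes f :: "'a \<Rightarrow> complex"
  assumes "sq_integrable M f"
  shows "sq_integrable M (\<lambda>x. c * f x)"
  using assms by (auto simp: sq_integrable_def power_mult_distrib norm_mult)

lemma sq_integrable_diff:
  fixes f g :: "'a \<Rightarrow> 'b::euclidean_space"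
  assumes "sq_integrable M f" "sq_integrable M g"
  shows "sq_integrable M (\<lambda>x. f x - g x)"
  using sq_integrable_add[OF assms(1) sq_integrable_scaleR[OF assms(2), of "-1"]] by simp

lemma sq_integrable_norm_mult:
  fixes f :: "'a \<Rightarrow> 'b::euclidean_space" and g :: "'a \<Rightarrow> 'c::euclidean_space"
  assumes "sq_integrable M f" "sq_integrable M g"
  shows "integrable M (\<lambda>x. norm (f x) * norm (g x))"
proof (rule Bochner_Integration.integrable_bound)
  have [measurable]: "f \<in> borel_measurable M" "g \<in> borel_measurable M"
    using assms by (auto simp: sq_integrable_def)
  show "(\<lambda>x. norm (f x) * norm (g x)) \<in> borel_measurable M" by measurable
  show "integrable M (\<lambda>x. (norm (f x))\<^sup>2 + (norm (g x))\<^sup>2)"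
    using assms by (auto simp: sq_integrable_def)
  have "norm (f x) * norm (g x) \<le> (norm (f x))\<^sup>2 + (norm (g x))\<^sup>2" for x
  proof -
    have "2 * (norm (f x) * norm (g x)) \<le> (norm (f x))\<^sup>2 + (norm (g x))\<^sup>2"
      using sum_squares_bound[of "norm (f x)" "norm (g x)"] by (simp add: mult.assoc)
    moreover have "0 \<le> norm (f x) * norm (g x)" by simp
    ultimately show ?thesis by linarith
  qed
  then show "AE x in M. norm (norm (f x) * norm (g x)) \<le> norm ((norm (f x))\<^sup>2 + (norm (g x))\<^sup>2)"
    by simp
qed

lemma sq_integrable_inner:
  fixes f g :: "'a \<Rightarrow> 'b::euclidean_space"
  assumes "sq_integrable M f" "sq_integrable M g"
  shows "integrable M (\<lambda>x. f x \<bullet> g x)"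
  by (rule Bochner_Integration.integrable_bound[OF sq_integrable_norm_mult[OF assms]])
    (use assms in \<open>auto simp: sq_integrable_def Cauchy_Schwarz_ineq2\<close>)

lemma sq_integrable_times:
  fixes f g :: "'a \<Rightarrow> complex"
  assumes "sq_integrable M f" "sq_integrable M g"
  shows "integrable M (\<lambda>x. f x * g x)"
  by (rule Bochner_Integration.integrable_bound[OF sq_integrable_norm_mult[OF assms]])
    (use assms in \<open>auto simp: sq_integrable_def norm_mult\<close>)

lemma integrable_indicator_scaleR:
  fixes c :: "'b::{banach, second_countable_topology}"
  assumes "S \<in> sets M" "emeasure M S < \<infinity>"
  shows "integrable M (\<lambda>x. indicator S x *\<^sub>R c)" "(\<integral>x. indicator S x *\<^sub>R c \<partial>M) = measure M S *\<^sub>R c"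
proof -
  have "has_bochner_integral M (\<lambda>x. indicator S x *\<^sub>R c) (measure M S *\<^sub>R c)"
    using assms by (intro has_bochner_integral_scaleR_left has_bochner_integral_real_indicator)
  then show "integrable M (\<lambda>x. indicator S x *\<^sub>R c)" "(\<integral>x. indicator S x *\<^sub>R c \<partial>M) = measure M S *\<^sub>R c"
    by (auto simp: has_bochner_integral_iff)
qed

lemma sq_integrable_restrict:
  fixes f :: "'a \<Rightarrow> 'b::euclidean_space"
  assumes "sq_integrable M f" "S \<in> sets M"
  shows "sq_integrable M (\<lambda>x. indicator S x *\<^sub>R f x)"
  by (rule sq_integrable_bound[OF assms(1)])
    (use assms in \<open>auto simp: sq_integrable_def indicator_def\<close>)

lemma sq_integrable_indicator:
  fixes c :: "'b::euclidean_space"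
  assumes "S \<in> sets M" "emeasure M S < \<infinity>"
  shows "sq_integrable M (\<lambda>x. indicator S x *\<^sub>R c)"
proof -
  have "(norm (indicator S x *\<^sub>R c))\<^sup>2 = indicator S x * (norm c)\<^sup>2" for x
    by (simp add: indicator_def)
  then show ?thesis using assms by (simp add: sq_integrable_def)
qed

lemma integrable_of_support:
  fixes b :: "'a \<Rightarrow> complex"
  assumes "sq_integrable M b" "R \<in> sets M" "emeasure M R < \<infinity>" "AE z in M. z \<notin> R \<longrightarrow> b z = 0"
  shows "integrable M b"
proof -
  have [measurable]: "b \<in> borel_measurable M" "R \<in> sets M"
    using assms by (auto simp: sq_integrable_def)
  have "integrable M (\<lambda>z. (indicator R z *\<^sub>R 1) * b z)"
    by (intro sq_integrable_times sq_integrable_indicator assms)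
  moreover have "AE z in M. (indicator R z *\<^sub>R 1) * b z = b z"
    using assms(4) by eventually_elim (auto simp: indicator_def)
  ultimately show ?thesis by (subst integrable_cong_AE[symmetric]) auto
qed

lemma integral_Cauchy_Schwarz:
  fixes f :: "'a \<Rightarrow> 'b::euclidean_space" and g :: "'a \<Rightarrow> 'c::euclidean_space"
  assumes f: "sq_integrable M f" and g: "sq_integrable M g"
  shows "(\<integral>x. norm (f x) * norm (g x) \<partial>M)
    \<le> sqrt (\<integral>x. (norm (f x))\<^sup>2 \<partial>M) * sqrt (\<integral>x. (norm (g x))\<^sup>2 \<partial>M)"
proof -
  have [measurable]: "f \<in> borel_measurable M" "g \<in> borel_measurable M"
    using f g by (auto simp: sq_integrable_def)
  have "ennreal ((\<integral>x. norm (f x) * norm (g x) \<partial>M)\<^sup>2)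
      = (\<integral>\<^sup>+x. ennreal (norm (f x)) * ennreal (norm (g x)) \<partial>M)\<^sup>2"
    using nn_integral_eq_integral[OF sq_integrable_norm_mult[OF f g]]
    by (simp add: ennreal_power[symmetric] ennreal_mult)
  also have "\<dots> \<le> (\<integral>\<^sup>+x. ennreal (norm (f x)) ^ 2 \<partial>M) * (\<integral>\<^sup>+x. ennreal (norm (g x)) ^ 2 \<partial>M)"
    by (rule Cauchy_Schwarz_nn_integral) measurable
  also have "\<dots> = ennreal ((\<integral>x. (norm (f x))\<^sup>2 \<partial>M) * (\<integral>x. (norm (g x))\<^sup>2 \<partial>M))"
    using f g by (simp add: sq_integrable_def ennreal_power nn_integral_eq_integral ennreal_mult)
  finally have "(\<integral>x. norm (f x) * norm (g x) \<partial>M)\<^sup>2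
      \<le> (\<integral>x. (norm (f x))\<^sup>2 \<partial>M) * (\<integral>x. (norm (g x))\<^sup>2 \<partial>M)"
    by (subst (asm) ennreal_le_iff) auto
  then show ?thesis by (metis real_le_rsqrt real_sqrt_mult)
qed

text \<open>Completeness of \<open>L\<^sup>2\<close> on an arbitrary measure space, for sequences that converge geometrically. With
  \<open>d\<^sub>n\<close> the pointwise distance of consecutive terms, \<open>\<Sum>n. 2\<^sup>n d\<^sub>n\<^sup>2\<close> has finite integral, so it is finite
  almost everywhere. As \<open>d\<^sub>n \<le> 2\<^sup>-\<^sup>n + 2\<^sup>n d\<^sub>n\<^sup>2\<close>, the \<open>d\<^sub>n\<close> are then summable and the sequence converges
  pointwise; Fatou's lemma transfers the Cauchy estimate to the limit.\<close>

lemma L2_complete: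
  fixes h :: "nat \<Rightarrow> 'a \<Rightarrow> 'b::euclidean_space"
  assumes h: "\<And>n. sq_integrable M (h n)"
    and cauchy: "\<And>n m. n \<le> m \<Longrightarrow> (\<integral>x. (norm (h m x - h n x))\<^sup>2 \<partial>M) \<le> C * (1/4) ^ n"
  obtains f where "sq_integrable M f"
    "\<And>n. (\<integral>x. (norm (f x - h n x))\<^sup>2 \<partial>M) \<le> C * (1/4) ^ n"
proof -
  have [measurable]: "h n \<in> borel_measurable M" for n using h by (auto simp: sq_integrable_def)
  have diff: "integrable M (\<lambda>x. (norm (h m x - h n x))\<^sup>2)" for m n
    using sq_integrable_diff[OF h h] by (auto simp: sq_integrable_def)
  have nn: "(\<integral>\<^sup>+x. ennreal ((norm (h m x - h n x))\<^sup>2) \<partial>M) \<le> ennreal (C * (1/4) ^ n)"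
    if "n \<le> m" for m n
    using cauchy[OF that] by (subst nn_integral_eq_integral[OF diff]) (auto intro!: ennreal_leI)
  have C: "C \<ge> 0" using cauchy[of 0 0] by simp
  let ?d = "\<lambda>n x. norm (h (Suc n) x - h n x)"
  have "(\<integral>\<^sup>+x. (\<Sum>n. ennreal (2 ^ n * (?d n x)\<^sup>2)) \<partial>M) = (\<Sum>n. \<integral>\<^sup>+x. ennreal (2 ^ n * (?d n x)\<^sup>2) \<partial>M)"
    by (rule nn_integral_suminf) measurable
  also have "\<dots> \<le> (\<Sum>n. ennreal (C * (1/2) ^ n))"
  proof (intro suminf_le summableI)
    fix n
    have "(\<integral>\<^sup>+x. ennreal (2 ^ n * (?d n x)\<^sup>2) \<partial>M) = ennreal (2 ^ n) * (\<integral>\<^sup>+x. ennreal ((?d n x)\<^sup>2) \<partial>M)"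
      by (subst nn_integral_cmult[symmetric]) (auto simp: ennreal_mult)
    also have "\<dots> \<le> ennreal (2 ^ n) * ennreal (C * (1/4) ^ n)"
      by (intro mult_left_mono nn) auto
    also have "\<dots> = ennreal (C * (1/2) ^ n)"
      using C by (simp add: ennreal_mult[symmetric] power_one_over field_simps power_mult_distrib[symmetric])
    finally show "(\<integral>\<^sup>+x. ennreal (2 ^ n * (?d n x)\<^sup>2) \<partial>M) \<le> ennreal (C * (1/2) ^ n)" .
  qed
  also have "\<dots> < \<infinity>"
    using C by (subst suminf_ennreal_eq[where x = "C * 2"]) (auto intro!: sums_mult geometric_sums[of "1/2::real", simplified])
  finally have "(\<integral>\<^sup>+x. (\<Sum>n. ennreal (2 ^ n * (?d n x)\<^sup>2)) \<partial>M) < \<infinity>" .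
  then have "AE x in M. (\<Sum>n. ennreal (2 ^ n * (?d n x)\<^sup>2)) \<noteq> \<infinity>"
    by (intro nn_integral_PInf_AE) auto
  then have conv: "AE x in M. convergent (\<lambda>n. h n x)"
  proof eventually_elim
    fix x assume "(\<Sum>n. ennreal (2 ^ n * (?d n x)\<^sup>2)) \<noteq> \<infinity>"
    then have s: "summable (\<lambda>n. 2 ^ n * (?d n x)\<^sup>2)"
      by (intro summable_suminf_not_top) auto
    have "summable (\<lambda>n. ?d n x)"
    proof (rule summable_comparison_test)
      show "summable (\<lambda>n. (1/2) ^ n + 2 ^ n * (?d n x)\<^sup>2)"
        by (intro summable_add s summable_geometric) auto
      have "?d n x \<le> (1/2) ^ n + 2 ^ n * (?d n x)\<^sup>2" for n
      proof -
        have "2 ^ n * ?d n x * 1 \<le> 1 + (2 ^ n * ?d n x)\<^sup>2"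
        proof -
          have "2 * (2 ^ n * ?d n x) \<le> 1 + (2 ^ n * ?d n x)\<^sup>2"
            using sum_squares_bound[of 1 "2 ^ n * ?d n x"] by simp
          moreover have "0 \<le> 2 ^ n * ?d n x" by simp
          ultimately show ?thesis by linarith
        qed
        then show ?thesis by (simp add: power_one_over field_simps power2_eq_square)
      qed
      then show "\<exists>N. \<forall>n\<ge>N. norm (?d n x) \<le> (1/2) ^ n + 2 ^ n * (?d n x)\<^sup>2" by auto
    qed
    then have "summable (\<lambda>n. h (Suc n) x - h n x)" by (rule summable_norm_cancel)
    then have "convergent (\<lambda>n. \<Sum>i<n. h (Suc i) x - h i x)" by (simp add: summable_iff_convergent)
    then show "convergent (\<lambda>n. h n x)"
      unfolding sum_lessThan_telescope[of "\<lambda>i. h i x"] convergent_diff_const_right_iff .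
  qed
  define f where "f x = lim (\<lambda>n. h n x)" for x
  have [measurable]: "f \<in> borel_measurable M"
    unfolding f_def by (rule borel_measurable_lim_metric) measurable
  have lim: "AE x in M. (\<lambda>m. h m x) \<longlonglongrightarrow> f x"
    using conv by eventually_elim (simp add: f_def convergent_LIMSEQ_iff)
  have fat: "(\<integral>\<^sup>+x. ennreal ((norm (f x - h n x))\<^sup>2) \<partial>M) \<le> ennreal (C * (1/4) ^ n)" for n
  proof -
    have "(\<integral>\<^sup>+x. ennreal ((norm (f x - h n x))\<^sup>2) \<partial>M)
       = (\<integral>\<^sup>+x. liminf (\<lambda>m. ennreal ((norm (h m x - h n x))\<^sup>2)) \<partial>M)"
    proof (rule nn_integral_cong_AE, use lim in eventually_elim)
      fix x assume "(\<lambda>m. h m x) \<longlonglongrightarrow> f x"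
      then have "(\<lambda>m. ennreal ((norm (h m x - h n x))\<^sup>2)) \<longlonglongrightarrow> ennreal ((norm (f x - h n x))\<^sup>2)"
        by (intro tendsto_intros)
      then show "ennreal ((norm (f x - h n x))\<^sup>2) = liminf (\<lambda>m. ennreal ((norm (h m x - h n x))\<^sup>2))"
        by (metis lim_imp_Liminf sequentially_bot)
    qed
    also have "\<dots> \<le> liminf (\<lambda>m. \<integral>\<^sup>+x. ennreal ((norm (h m x - h n x))\<^sup>2) \<partial>M)"
      by (rule nn_integral_liminf) measurable
    also have "\<dots> \<le> liminf (\<lambda>m. ennreal (C * (1/4) ^ n))"
      by (rule Liminf_mono) (auto simp: eventually_sequentially intro!: exI[of _ n] nn)
    also have "\<dots> = ennreal (C * (1/4) ^ n)" by (simp add: Liminf_const)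
    finally show ?thesis .
  qed
  have fi: "integrable M (\<lambda>x. (norm (f x - h n x))\<^sup>2)" for n
  proof (rule integrableI_bounded)
    show "(\<integral>\<^sup>+x. ennreal (norm ((norm (f x - h n x))\<^sup>2)) \<partial>M) < \<infinity>"
      using fat[of n] by (simp add: le_less_trans[OF _ ennreal_less_top])
  qed measurable
  show ?thesis
  proof
    have "sq_integrable M (\<lambda>x. (f x - h 0 x) + h 0 x)"
      by (rule sq_integrable_add[OF _ h]) (use fi in \<open>auto simp: sq_integrable_def\<close>)
    then show "sq_integrable M f" by simp
    show "(\<integral>x. (norm (f x - h n x))\<^sup>2 \<partial>M) \<le> C * (1/4) ^ n" for n
      using fat[of n] C by (subst (asm) nn_integral_eq_integral[OF fi]) auto
  qed
qed

text \<open>The representer minimises \<open>J g = \<parallel>g\<parallel>\<^sup>2 - 2 T g\<close>. By the parallelogram law a minimising sequence is Cauchy, and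
  perturbing it in the direction \<open>v\<close> gives in the limit \<open>t\<^sup>2 \<parallel>v\<parallel>\<^sup>2 + 2 t (\<langle>f, v\<rangle> - T v) \<ge> 0\<close> for all real \<open>t\<close>,
  which forces \<open>T v = \<langle>f, v\<rangle>\<close>.\<close>

lemma L2_Riesz_representation:
  fixes T :: "('a \<Rightarrow> 'b::euclidean_space) \<Rightarrow> real"
  assumes add: "\<And>g h. sq_integrable M g \<Longrightarrow> sq_integrable M h \<Longrightarrow> T (\<lambda>x. g x + h x) = T g + T h"
    and scale: "\<And>c g. sq_integrable M g \<Longrightarrow> T (\<lambda>x. c *\<^sub>R g x) = c * T g"
    and bound: "\<And>g. sq_integrable M g \<Longrightarrow> (T g)\<^sup>2 \<le> K * (\<integral>x. (norm (g x))\<^sup>2 \<partial>M)"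
    and K: "K \<ge> 0"
  obtains f where "sq_integrable M f" "\<And>g. sq_integrable M g \<Longrightarrow> T g = (\<integral>x. f x \<bullet> g x \<partial>M)"
proof -
  define N where "N g = (\<integral>x. (norm (g x))\<^sup>2 \<partial>M)" for g :: "'a \<Rightarrow> 'b"
  define J where "J g = N g - 2 * T g" for g
  define V where "V = {g :: 'a \<Rightarrow> 'b. sq_integrable M g}"
  have int: "integrable M (\<lambda>x. (norm (g x))\<^sup>2)" if "g \<in> V" for g
    using that by (simp add: V_def sq_integrable_def)
  have N_nonneg: "N g \<ge> 0" for g by (simp add: N_def)
  have N_scale: "N (\<lambda>x. c *\<^sub>R g x) = c\<^sup>2 * N g" for c g
    by (simp add: N_def power_mult_distrib)
  have N_add: "N (\<lambda>x. g x + h x) = N g + 2 * (\<integral>x. g x \<bullet> h x \<partial>M) + N h" if "g \<in> V" "h \<in> V" for g h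
  proof -
    have "N (\<lambda>x. g x + h x) = (\<integral>x. (norm (g x))\<^sup>2 + 2 * (g x \<bullet> h x) + (norm (h x))\<^sup>2 \<partial>M)"
      unfolding N_def by (intro Bochner_Integration.integral_cong refl)
        (simp add: power2_norm_eq_inner inner_add inner_commute)
    then show ?thesis
      using int that sq_integrable_inner[of M g h] by (simp add: N_def V_def)
  qed
  have V_add: "(\<lambda>x. g x + h x) \<in> V" if "g \<in> V" "h \<in> V" for g h
    using that by (simp add: V_def sq_integrable_add)
  have V_scale: "(\<lambda>x. c *\<^sub>R g x) \<in> V" if "g \<in> V" for c g
    using that by (simp add: V_def sq_integrable_scaleR)
  have J_lower: "- K \<le> J g" if "g \<in> V" for g
  proof -
    have "(T g)\<^sup>2 \<le> K * N g" using bound[of g] that by (simp add: V_def N_def)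
    then have "T g \<le> sqrt (K * N g)" by (rule real_le_rsqrt)
    also have "\<dots> \<le> (K + N g) / 2" by (rule arith_geo_mean_sqrt[OF K N_nonneg])
    finally show ?thesis by (simp add: J_def)
  qed
  \<comment> \<open>Near-minimisers within \<open>4\<^sup>-\<^sup>n\<close> of the infimum are Cauchy at the rate required for completeness.\<close>
  define m where "m = Inf (J ` V)"
  have bdd: "bdd_below (J ` V)" using J_lower by (auto intro!: bdd_belowI)
  have zero: "(\<lambda>_. 0) \<in> V" by (simp add: V_def sq_integrable_def)
  have m_le: "m \<le> J g" if "g \<in> V" for g
    unfolding m_def by (intro cInf_lower bdd imageI that)
  have "\<exists>g\<in>V. J g < m + (1/4) ^ n" for n :: nat
  proof -
    have "m < m + (1/4) ^ n" by simp
    then show ?thesis unfolding m_def using zero by (subst (asm) cInf_less_iff) (use bdd in auto)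
  qed
  then obtain g where gV: "g n \<in> V" and gJ: "J (g n) < m + (1/4) ^ n" for n :: nat
    by metis
  have parallelogram: "N (\<lambda>x. h x - k x) = 2 * J h + 2 * J k - 4 * J (\<lambda>x. (1/2) *\<^sub>R (h x + k x))"
    if "h \<in> V" "k \<in> V" for h k
  proof -
    have "N (\<lambda>x. h x - k x) = 2 * N h + 2 * N k - N (\<lambda>x. h x + k x)"
      using N_add[OF that] N_add[OF that(1) V_scale[OF that(2), of "-1"]] N_scale[of "-1" k] by simp
    moreover have "T (\<lambda>x. (1/2) *\<^sub>R (h x + k x)) = (T h + T k) / 2"
      using that V_add[OF that] add[of h k] scale[of "\<lambda>x. h x + k x" "1/2"] by (simp add: V_def)
    moreover have "N (\<lambda>x. (1/2) *\<^sub>R (h x + k x)) = N (\<lambda>x. h x + k x) / 4"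
      by (subst N_scale) (simp add: power2_eq_square)
    ultimately show ?thesis by (simp add: J_def)
  qed
  have "(\<integral>x. (norm (g k x - g n x))\<^sup>2 \<partial>M) \<le> 4 * (1/4) ^ n" if "n \<le> k" for n k
  proof -
    have "m \<le> J (\<lambda>x. (1/2) *\<^sub>R (g k x + g n x))"
      by (intro m_le V_scale V_add gV)
    moreover have "(1/4 :: real) ^ k \<le> (1/4) ^ n" using that by (intro power_decreasing) auto
    ultimately show ?thesis
      using parallelogram[OF gV[of k] gV[of n]] gJ[of n] gJ[of k] unfolding N_def by linarith
  qed
  note cauchy = this
  have sq: "sq_integrable M (g n)" for n using gV by (simp add: V_def)
  obtain f where f: "sq_integrable M f"
    and conv: "\<And>n. (\<integral>x. (norm (f x - g n x))\<^sup>2 \<partial>M) \<le> 4 * (1/4) ^ n"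
    using L2_complete[of M g 4, OF sq cauchy] by blast
  have "T v = (\<integral>x. f x \<bullet> v x \<partial>M)" if "sq_integrable M v" for v
  proof -
    have v: "v \<in> V" using that by (simp add: V_def)
    define A D where "A = N v" "D = (\<integral>x. f x \<bullet> v x \<partial>M) - T v"
    have diff: "norm ((\<integral>x. g n x \<bullet> v x \<partial>M) - (\<integral>x. f x \<bullet> v x \<partial>M)) \<le> (1/2) ^ n * (2 * sqrt (N v))" for n
    proof -
      have gn: "sq_integrable M (g n)" using gV by (simp add: V_def)
      have "(\<integral>x. g n x \<bullet> v x \<partial>M) - (\<integral>x. f x \<bullet> v x \<partial>M) = (\<integral>x. (g n x - f x) \<bullet> v x \<partial>M)"
        using sq_integrable_inner[OF gn that] sq_integrable_inner[OF f that]
        by (simp add: inner_diff_left)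
      also have "norm \<dots> \<le> (\<integral>x. norm (g n x - f x) * norm (v x) \<partial>M)"
        by (rule order_trans[OF integral_norm_bound], rule integral_mono)
          (auto intro!: sq_integrable_inner sq_integrable_norm_mult sq_integrable_diff gn f that
            integrable_norm Cauchy_Schwarz_ineq2)
      also have "\<dots> \<le> sqrt (\<integral>x. (norm (g n x - f x))\<^sup>2 \<partial>M) * sqrt (N v)"
        unfolding N_def by (intro integral_Cauchy_Schwarz sq_integrable_diff gn f that)
      also have "\<dots> \<le> sqrt (4 * (1/4) ^ n) * sqrt (N v)"
        using conv[of n] by (intro mult_right_mono) (auto simp: norm_minus_commute N_nonneg)
      also have "sqrt (4 * (1/4) ^ n) = 2 * (1/2) ^ n"
        by (simp add: real_sqrt_mult real_sqrt_power real_sqrt_divide)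
      finally show ?thesis by (simp add: mult_ac)
    qed
    have lim: "(\<lambda>n. \<integral>x. g n x \<bullet> v x \<partial>M) \<longlonglongrightarrow> (\<integral>x. f x \<bullet> v x \<partial>M)"
      by (subst LIM_zero_iff[symmetric], rule Lim_null_comparison[OF always_eventually[OF allI[OF diff]]])
        (auto intro!: tendsto_mult_left_zero LIMSEQ_realpow_zero)
    have "0 \<le> t\<^sup>2 * A + 2 * t * D" for t
    proof (rule LIMSEQ_le)
      show "(\<lambda>n. - ((1/4) ^ n)) \<longlonglongrightarrow> (0::real)"
        using tendsto_minus[OF LIMSEQ_realpow_zero[of "1/4 :: real"]] by simp
      show "(\<lambda>n. t\<^sup>2 * A + 2 * t * ((\<integral>x. g n x \<bullet> v x \<partial>M) - T v)) \<longlonglongrightarrow> t\<^sup>2 * A + 2 * t * D"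
        unfolding A_D_def(2) by (intro tendsto_intros lim)
      have "- ((1/4) ^ n) \<le> t\<^sup>2 * A + 2 * t * ((\<integral>x. g n x \<bullet> v x \<partial>M) - T v)" for n
      proof -
        have "m \<le> J (\<lambda>x. g n x + t *\<^sub>R v x)" by (intro m_le V_add V_scale gV v)
        also have "\<dots> = J (g n) + t\<^sup>2 * A + 2 * t * ((\<integral>x. g n x \<bullet> v x \<partial>M) - T v)"
          using N_add[OF gV[of n] V_scale[OF v, of t]] N_scale[of t v]
            add[of "g n" "\<lambda>x. t *\<^sub>R v x"] scale[OF that, of t] gV[of n] V_scale[OF v, of t]
          by (simp add: J_def A_D_def V_def algebra_simps)
        finally show ?thesis using gJ[of n] by linarith
      qed
      then show "\<exists>N. \<forall>n\<ge>N. - ((1/4) ^ n) \<le> t\<^sup>2 * A + 2 * t * ((\<integral>x. g n x \<bullet> v x \<partial>M) - T v)" by blast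
    qed
    note quad = this
    have "A \<ge> 0" by (simp add: A_D_def N_nonneg)
    have "D = 0"
    proof (rule ccontr)
      assume "D \<noteq> 0"
      \<comment> \<open>The quadratic is tested near its minimiser \<open>-D/A\<close>; the shift avoids \<open>A = 0\<close>.\<close>
      have "(- D / (A + 1))\<^sup>2 * A + 2 * (- D / (A + 1)) * D = - (D\<^sup>2 * (A + 2)) / (A + 1)\<^sup>2"
        using \<open>A \<ge> 0\<close> by (simp add: divide_simps) (simp add: power2_eq_square algebra_simps)
      also have "\<dots> < 0"
        using \<open>A \<ge> 0\<close> \<open>D \<noteq> 0\<close> by (simp add: divide_neg_pos)
      finally show False using quad[of "- D / (A + 1)"] by linarith
    qed
    then show ?thesis by (simp add: A_D_def)
  qed
  with f that show ?thesis by blast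
qed

text \<open>Over the reals, \<open>Re \<circ> T\<close> is represented by \<open>u\<close> for the inner product \<open>u \<bullet> g = Re (cnj u * g)\<close>. Hence \<open>cnj u\<close>
  represents \<open>T\<close> up to imaginary parts, which complex linearity recovers from \<open>Im (T g) = Re (T (- \<i> g))\<close>.\<close>

lemma L2_Riesz_representation_complex:
  fixes T :: "('a \<Rightarrow> complex) \<Rightarrow> complex"
  assumes add: "\<And>g h. sq_integrable M g \<Longrightarrow> sq_integrable M h \<Longrightarrow> T (\<lambda>x. g x + h x) = T g + T h"
    and scale: "\<And>c g. sq_integrable M g \<Longrightarrow> T (\<lambda>x. c * g x) = c * T g"
    and bound: "\<And>g. sq_integrable M g \<Longrightarrow> (cmod (T g))\<^sup>2 \<le> K * (\<integral>x. (cmod (g x))\<^sup>2 \<partial>M)"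
    and K: "K \<ge> 0"
  obtains f where "sq_integrable M f" "\<And>g. sq_integrable M g \<Longrightarrow> T g = (\<integral>x. f x * g x \<partial>M)"
proof -
  obtain u where u: "sq_integrable M u"
    and Re_T: "\<And>g. sq_integrable M g \<Longrightarrow> Re (T g) = (\<integral>x. u x \<bullet> g x \<partial>M)"
  proof (rule L2_Riesz_representation[of M "\<lambda>g. Re (T g)" K])
    fix g h :: "'a \<Rightarrow> complex" assume "sq_integrable M g" "sq_integrable M h"
    then show "Re (T (\<lambda>x. g x + h x)) = Re (T g) + Re (T h)" by (simp add: add)
  next
    fix c and g :: "'a \<Rightarrow> complex" assume "sq_integrable M g"
    then show "Re (T (\<lambda>x. c *\<^sub>R g x)) = c * Re (T g)" by (simp add: scaleR_conv_of_real scale)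
  next
    fix g :: "'a \<Rightarrow> complex" assume g: "sq_integrable M g"
    have "(Re (T g))\<^sup>2 \<le> (cmod (T g))\<^sup>2" by (simp add: cmod_power2)
    also have "\<dots> \<le> K * (\<integral>x. (cmod (g x))\<^sup>2 \<partial>M)" by (rule bound[OF g])
    finally show "(Re (T g))\<^sup>2 \<le> K * (\<integral>x. (cmod (g x))\<^sup>2 \<partial>M)" .
  qed (use K in auto)
  have inner: "u x \<bullet> v = Re (cnj (u x) * v)" for x v by (simp add: inner_complex_def)
  have cu: "sq_integrable M (\<lambda>x. cnj (u x))"
  proof (rule sq_integrable_bound[OF u])
    have "cnj \<in> borel_measurable borel" by (intro borel_measurable_continuous_onI continuous_intros)
    then show "(\<lambda>x. cnj (u x)) \<in> borel_measurable M"
      using u unfolding sq_integrable_def by (blast intro: measurable_compose)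
  qed simp
  have Re_eq: "Re (T g) = Re (\<integral>x. cnj (u x) * g x \<partial>M)" if g: "sq_integrable M g" for g :: "'a \<Rightarrow> complex"
    using Re_T[OF g] sq_integrable_times[OF cu g] by (simp only: inner integral_Re)
  show ?thesis
  proof (rule that[OF cu])
    fix g :: "'a \<Rightarrow> complex" assume g: "sq_integrable M g"
    have "Im (T g) = Re (T (\<lambda>x. - \<i> * g x))" unfolding scale[OF g] by simp
    also have "\<dots> = Re (\<integral>x. cnj (u x) * (- \<i> * g x) \<partial>M)"
      by (rule Re_eq[OF sq_integrable_mult[OF g]])
    also have "(\<lambda>x. cnj (u x) * (- \<i> * g x)) = (\<lambda>x. - \<i> * (cnj (u x) * g x))" by (simp add: fun_eq_iff)
    also have "(\<integral>x. - \<i> * (cnj (u x) * g x) \<partial>M) = - \<i> * (\<integral>x. cnj (u x) * g x \<partial>M)"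
      by (rule Bochner_Integration.integral_mult_right_zero)
    finally have "Im (T g) = Im (\<integral>x. cnj (u x) * g x \<partial>M)" by simp
    with Re_eq[OF g] show "T g = (\<integral>x. cnj (u x) * g x \<partial>M)" by (rule complex_eqI)
  qed
qed

section \<open>The right Haar measure on Calderon--Zygmund sets\<close>

lemma AxB_borel: "AxB \<in> sets borel"
  unfolding AxB_def by (rule borel_open, rule open_Times) auto

lemma sets_rho: "sets rho = sets (restrict_space borel AxB)"
  by (simp add: rho_def sets_restrict_space)

lemma sets_rho_iff: "S \<in> sets rho \<longleftrightarrow> S \<in> sets borel \<and> S \<subseteq> AxB"
  using sets_restrict_space_iff[of AxB borel S] AxB_borel by (auto simp: sets_rho)

lemma measurable_rho: "f \<in> measurable borel N \<Longrightarrow> f \<in> measurable rho N"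
  by (metis measurable_cong_sets measurable_restrict_space1 sets_rho)

lemma measurable_projections [measurable]:
  "(fst :: (real ^ 'n) \<times> real \<Rightarrow> _) \<in> borel_measurable borel"
  "(snd :: (real ^ 'n) \<times> real \<Rightarrow> _) \<in> borel_measurable borel"
  "(\<lambda>x :: real ^ 'n. x $ i) \<in> borel_measurable borel"
  by (intro borel_measurable_continuous_onI continuous_intros)+

lemma emeasure_rho:
  fixes S :: "((real ^ 'n) \<times> real) set"
  assumes "S \<in> sets rho"
  shows "emeasure rho S = (\<integral>\<^sup>+z. ennreal (1 / snd z) * indicator S z \<partial>lborel)"
proof -
  have S: "S \<in> sets borel" "S \<subseteq> AxB" using assms by (auto simp: sets_rho_iff)
  have "(\<lambda>z :: (real ^ 'n) \<times> real. ennreal (1 / snd z)) \<in> borel_measurable borel"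
    by measurable
  then have "(\<lambda>z. ennreal (1 / snd z)) \<in> borel_measurable (restrict_space lborel (AxB :: ((real ^ 'n) \<times> real) set))"
    by (intro measurable_restrict_space1) simp
  moreover have "S \<in> sets (restrict_space lborel AxB)"
    using assms by (simp add: sets_rho cong: sets_restrict_space_cong)
  ultimately have "emeasure rho S
      = (\<integral>\<^sup>+z. ennreal (1 / snd z) * indicator S z \<partial>restrict_space lborel AxB)"
    unfolding rho_def by (subst emeasure_density) (auto simp: case_prod_beta')
  also have "\<dots> = (\<integral>\<^sup>+z. ennreal (1 / snd z) * indicator S z * indicator AxB z \<partial>lborel)"
    using AxB_borel by (intro nn_integral_restrict_space) simp
  also have "\<dots> = (\<integral>\<^sup>+z. ennreal (1 / snd z) * indicator S z \<partial>lborel)"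
    using S(2) by (intro nn_integral_cong) (auto simp: indicator_def)
  finally show ?thesis .
qed

lemma compact_sets_rho: "compact K \<Longrightarrow> K \<subseteq> AxB \<Longrightarrow> K \<in> sets rho"
  by (simp add: sets_rho_iff borel_compact)

lemma emeasure_rho_compact:
  fixes K :: "((real ^ 'n) \<times> real) set"
  assumes K: "compact K" "K \<subseteq> AxB"
  shows "emeasure rho K < \<infinity>"
proof -
  have "compact ((\<lambda>z. 1 / snd z) ` K)"
    using K by (intro compact_continuous_image continuous_intros) (auto simp: AxB_def)
  then obtain B where bound: "\<forall>y\<in>(\<lambda>z. 1 / snd z) ` K. norm y \<le> B"
    by (metis bounded_iff compact_imp_bounded)
  then have B: "1 / snd z \<le> B" if "z \<in> K" for z
  proof -
    have "norm (1 / snd z) \<le> B" using bound that by (rule bspec[OF _ imageI])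
    then show ?thesis unfolding real_norm_def by linarith
  qed
  have "emeasure rho K = (\<integral>\<^sup>+z. ennreal (1 / snd z) * indicator K z \<partial>lborel)"
    using K by (intro emeasure_rho compact_sets_rho)
  also have "\<dots> \<le> (\<integral>\<^sup>+z. ennreal B * indicator K z \<partial>lborel)"
    by (intro nn_integral_mono) (simp add: indicator_def ennreal_leI B)
  also have "\<dots> = ennreal B * emeasure lborel K"
    using K by (subst nn_integral_cmult_indicator) (auto simp: borel_compact)
  also have "\<dots> < \<infinity>"
    using K emeasure_compact_finite[of K] by (simp add: ennreal_mult_less_top)
  finally show ?thesis .
qed

text \<open>The density \<open>1 / a\<close> is strictly positive, so a null set for \<open>rho\<close> is Lebesgue null and has empty interior.\<close>

lemma emeasure_rho_pos:
  fixes R :: "((real ^ 'n) \<times> real) set"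
  assumes "open U" "u \<in> U" "U \<subseteq> R" "R \<in> sets rho"
  shows "emeasure rho R \<noteq> 0"
proof
  have R: "R \<in> sets borel" "R \<subseteq> AxB" using assms(4) by (auto simp: sets_rho_iff)
  assume "emeasure rho R = 0"
  then have "AE z in lborel. ennreal (1 / snd z) * indicator R z = 0"
    using R by (subst (asm) emeasure_rho[OF assms(4)], subst (asm) nn_integral_0_iff_AE) auto
  then have "AE z in lborel. z \<notin> R"
    by eventually_elim (use R in \<open>auto simp: indicator_def AxB_def split: if_splits\<close>)
  then have "R \<in> null_sets lborel"
    using R by (subst AE_iff_null_sets) auto
  then have "negligible R"
    by (simp add: negligible_iff_null_sets null_sets_completionI)
  then have "negligible U" using assms(3) by (rule negligible_subset)
  then show False using open_not_negligible assms by blast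
qed

lemma dyadic_cube_borel:
  fixes m :: "int ^ 'n"
  shows "dyadic_cube k m \<in> sets borel"
proof -
  have "{x \<in> space borel. \<forall>i. of_int (m $ i) * 2 powi k \<le> x $ i \<and> x $ i < (of_int (m $ i) + 1) * 2 powi k}
      \<in> sets (borel :: (real ^ 'n) measure)"
    by measurable
  then show ?thesis by (simp add: dyadic_cube_def)
qed

lemma dyadic_cube_subset_cbox:
  "dyadic_cube k m \<subseteq> cbox (\<chi> i. of_int (m $ i) * 2 powi k) (\<chi> i. (of_int (m $ i) + 1) * 2 powi k)"
  by (simp add: dyadic_cube_def mem_box_cart subset_iff less_imp_le)

lemma box_subset_dyadic_cube:
  "box (\<chi> i. of_int (m $ i) * 2 powi k) (\<chi> i. (of_int (m $ i) + 1) * 2 powi k) \<subseteq> dyadic_cube k m"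
  by (simp add: dyadic_cube_def mem_box_cart subset_iff less_imp_le)

lemma CZ_subset_compact:
  assumes "R \<in> CZ_sets"
  obtains K where "compact K" "R \<subseteq> K" "K \<subseteq> AxB"
proof -
  obtain k m a r where R: "R = dyadic_cube k m \<times> {a * exp (- r)..a * exp r}" "a > 0"
    using assms by (auto simp: CZ_sets_def)
  show ?thesis
  proof
    let ?K = "cbox (\<chi> i. of_int (m $ i) * 2 powi k) (\<chi> i. (of_int (m $ i) + 1) * 2 powi k)
       \<times> {a * exp (- r)..a * exp r}"
    show "compact ?K" by (intro compact_Times compact_cbox compact_Icc)
    show "R \<subseteq> ?K" using dyadic_cube_subset_cbox R by fastforce
    have "a * exp (- r) > 0" using R by simp
    then show "?K \<subseteq> AxB" by (auto simp: AxB_def)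
  qed
qed

lemma CZ_sets_rho:
  assumes "R \<in> CZ_sets"
  shows "R \<in> sets rho"
proof -
  obtain k m a r where R: "R = dyadic_cube k m \<times> {a * exp (- r)..a * exp r}"
    using assms by (auto simp: CZ_sets_def)
  have "R \<in> sets borel" unfolding R by (rule borel_Times) (auto simp: dyadic_cube_borel)
  with CZ_subset_compact[OF assms] show ?thesis by (metis order_trans sets_rho_iff)
qed

lemma CZ_finite: "R \<in> CZ_sets \<Longrightarrow> emeasure rho R < \<infinity>"
  by (metis CZ_subset_compact compact_sets_rho emeasure_mono emeasure_rho_compact le_less_trans)

lemma CZ_pos:
  fixes R :: "((real ^ 'n) \<times> real) set"
  assumes "R \<in> CZ_sets"
  shows "measure rho R > 0"
proof -
  obtain k m a r where R: "R = dyadic_cube k m \<times> {a * exp (- r)..a * exp r}" "a > 0" "r > 0"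
    using assms by (auto simp: CZ_sets_def)
  define B :: "(real ^ 'n) set"
    where "B = box (\<chi> i. of_int (m $ i) * 2 powi k) (\<chi> i. (of_int (m $ i) + 1) * 2 powi k)"
  define I where "I = {a * exp (- r)<..<a * exp r}"
  have "emeasure rho R \<noteq> 0"
  proof (rule emeasure_rho_pos)
    have "(\<chi> i. (real_of_int (m $ i) + 1/2) * 2 powi k) \<in> B"
      by (simp add: B_def mem_box_cart)
    moreover have "a \<in> I" using R by (simp add: I_def)
    ultimately show "(\<chi> i. (real_of_int (m $ i) + 1/2) * 2 powi k, a) \<in> B \<times> I"
      by (rule SigmaI)
    show "B \<times> I \<subseteq> R"
      unfolding R B_def I_def by (intro Sigma_mono box_subset_dyadic_cube) (simp add: subset_iff)
    show "open (B \<times> I)"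
      unfolding B_def I_def by (intro open_Times open_box open_greaterThanLessThan)
    show "R \<in> sets rho" by (rule CZ_sets_rho[OF assms])
  qed
  then show ?thesis
    using CZ_finite[OF assms] by (simp add: measure_def enn2real_positive_iff zero_less_iff_neq_zero)
qed

section \<open>Exhausting the half-space over each orthant\<close>

text \<open>The orthant containing \<open>fst z\<close>, encoded as the lattice vector \<open>c\<close> for which the cubes
  \<open>dyadic_cube k c\<close>, all \<open>k\<close>, lie in that orthant and touch the origin; these cubes increase with \<open>k\<close>.\<close>

definition corner :: "(real ^ 'n) \<times> real \<Rightarrow> int ^ 'n" where
  "corner z = (\<chi> i. if fst z $ i \<ge> 0 then 0 else - 1)"

text \<open>The centre of the vertical interval is \<open>1\<close> and \<open>r = n + 1\<close>, so that the condition for \<open>r \<ge> 1\<close> on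
  Calderon--Zygmund sets applies from the start; the side is \<open>16\<^sup>r\<close>.\<close>

definition tower :: "nat \<Rightarrow> int ^ 'n \<Rightarrow> ((real ^ 'n) \<times> real) set" where
  "tower n c = dyadic_cube (int (4 * Suc n)) c \<times> {exp (- real (Suc n))..exp (real (Suc n))}"

lemma tower_CZ: "tower n c \<in> CZ_sets"
proof -
  have e: "exp (1::real) \<le> 3" "2 \<le> exp (1 :: real)"
    using exp_le exp_ge_add_one_self[of "1::real"] by simp_all
  \<comment> \<open>The side \<open>16\<^sup>r\<close> is admissible because \<open>e\<^sup>2 \<le> 9 \<le> 16 = 2\<^sup>4 \<le> e\<^sup>4 < e\<^sup>8\<close>.\<close>
  let ?r = "real (Suc n)"
  have "exp (2 * ?r) = (exp 1 ^ 2) ^ Suc n"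
    by (subst power_mult[symmetric], subst exp_of_nat_mult[symmetric]) simp
  also have "\<dots> \<le> (2 ^ 4) ^ Suc n"
  proof (rule power_mono)
    have "exp 1 ^ 2 \<le> (3::real) ^ 2" using e by (intro power_mono) auto
    then show "exp 1 ^ 2 \<le> (2 :: real) ^ 4" by simp
  qed simp
  finally have 1: "exp (2 * ?r) \<le> 2 powi int (4 * Suc n)"
    by (simp only: power_int_of_nat power_mult)
  have "(2::real) ^ (4 * Suc n) \<le> exp 1 ^ (4 * Suc n)"
    using e by (intro power_mono) auto
  also have "\<dots> = exp (4 * ?r)" by (subst exp_of_nat_mult[symmetric]) simp
  also have "\<dots> < exp (8 * ?r)" by simp
  finally have 2: "2 powi int (4 * Suc n) < exp (8 * ?r)" by (simp only: power_int_of_nat)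
  show ?thesis
    unfolding CZ_sets_def mem_Collect_eq
    by (rule exI[of _ "int (4 * Suc n)"], rule exI[of _ c], rule exI[of _ 1], rule exI[of _ ?r])
      (use 1 2 in \<open>simp add: tower_def\<close>)
qed

text \<open>A dyadic cube does not cross the coordinate hyperplanes: its lower corner is a multiple of its side
  and its upper faces are excluded.\<close>

lemma corner_dyadic_cube:
  assumes "x \<in> dyadic_cube k m"
  shows "corner (x, a) = (\<chi> i. if m $ i \<ge> 0 then 0 else - 1)"
proof -
  have "0 \<le> x $ i \<longleftrightarrow> 0 \<le> m $ i" for i
  proof
    have x: "of_int (m $ i) * 2 powi k \<le> x $ i" "x $ i < (of_int (m $ i) + 1) * 2 powi k"
      using assms by (auto simp: dyadic_cube_def)
    show "0 \<le> x $ i" if "0 \<le> m $ i"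
      using x(1) that by (meson mult_nonneg_nonneg of_int_nonneg order_trans zero_le_numeral zero_le_power_int)
    show "0 \<le> m $ i" if "0 \<le> x $ i"
    proof (rule ccontr)
      assume "\<not> 0 \<le> m $ i"
      then have "real_of_int (m $ i) + 1 \<le> 0" by linarith
      then have "(real_of_int (m $ i) + 1) * 2 powi k \<le> 0" by (simp add: mult_nonpos_nonneg)
      with x that show False by linarith
    qed
  qed
  then show ?thesis by (simp add: corner_def vec_eq_iff)
qed

lemma corner_tower:
  assumes "z \<in> tower n (corner w)"
  shows "corner z = corner w"
proof -
  have "fst z \<in> dyadic_cube (int (4 * Suc n)) (corner w)" using assms by (auto simp: tower_def)
  from corner_dyadic_cube[OF this, of "snd z"] show ?thesis
    by (simp add: corner_def vec_eq_iff)
qed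

lemma mem_tower:
  assumes "z \<in> AxB" "norm (fst z) + \<bar>ln (snd z)\<bar> \<le> real n"
  shows "z \<in> tower n (corner z)"
proof -
  have pos: "snd z > 0" using assms by (auto simp: AxB_def)
  have ln: "ln (snd z) \<le> real n" "- real n \<le> ln (snd z)" "norm (fst z) \<le> real n"
    using assms(2) norm_ge_zero[of "fst z"] by linarith+
  have "snd z = exp (ln (snd z))" using pos by simp
  moreover have "exp (- real (Suc n)) \<le> exp (ln (snd z))" "exp (ln (snd z)) \<le> exp (real (Suc n))"
    using ln by auto
  ultimately have "exp (- real (Suc n)) \<le> snd z" "snd z \<le> exp (real (Suc n))"
    by simp_all
  moreover have "fst z \<in> dyadic_cube (int (4 * Suc n)) (corner z)"
  proof -
    have "real n < 2 ^ n" by (rule of_nat_less_two_power)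
    also have "(2::real) ^ n \<le> 2 ^ (4 * Suc n)" by (intro power_increasing) auto
    finally have "\<bar>fst z $ i\<bar> < 2 powi int (4 * Suc n)" for i
      using component_le_norm_cart[of "fst z" i] ln unfolding power_int_of_nat by linarith
    then show ?thesis
      by (auto simp: dyadic_cube_def corner_def abs_less_iff minus_less_iff less_imp_le not_le)
  qed
  ultimately show ?thesis by (simp add: tower_def mem_Times_iff)
qed

lemma compact_subset_towers:
  assumes "compact K" "K \<subseteq> AxB"
  obtains N where "\<And>z. z \<in> K \<Longrightarrow> z \<in> tower N (corner z)"
proof -
  have "compact ((\<lambda>z. norm (fst z) + \<bar>ln (snd z)\<bar>) ` K)"
    using assms by (intro compact_continuous_image continuous_intros) (auto simp: AxB_def)
  then obtain B where B: "\<forall>y\<in>(\<lambda>z. norm (fst z) + \<bar>ln (snd z)\<bar>) ` K. norm y \<le> B"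
    by (metis bounded_iff compact_imp_bounded)
  obtain N where N: "B \<le> real N" using real_arch_simple by blast
  show ?thesis
  proof (rule that, rule mem_tower)
    fix z assume z: "z \<in> K"
    then show "z \<in> AxB" using assms by blast
    have "norm (norm (fst z) + \<bar>ln (snd z)\<bar>) \<le> B" using B z by (rule bspec[OF _ imageI])
    then show "norm (fst z) + \<bar>ln (snd z)\<bar> \<le> real N" using N by simp
  qed
qed

text \<open>Boundedness puts the set into the towers of a common level, and the dyadic base selects one orthant.\<close>

lemma CZ_subset_tower:
  assumes "R \<in> CZ_sets"
  obtains N w where "R \<subseteq> tower N (corner w)"
proof -
  obtain k m a r where R: "R = dyadic_cube k m \<times> {a * exp (- r)..a * exp r}"
    using assms by (auto simp: CZ_sets_def)
  obtain K where K: "compact K" "R \<subseteq> K" "K \<subseteq> AxB" by (rule CZ_subset_compact[OF assms])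
  obtain N where N: "\<And>z. z \<in> K \<Longrightarrow> z \<in> tower N (corner z)"
    using compact_subset_towers[OF K(1,3)] by blast
  have same: "corner z = corner w" if "z \<in> R" "w \<in> R" for z w
    using that corner_dyadic_cube[of "fst z" k m "snd z"] corner_dyadic_cube[of "fst w" k m "snd w"]
    by (auto simp: R)
  show ?thesis
  proof (cases "R = {}")
    case False
    then obtain w where "w \<in> R" by blast
    then have "R \<subseteq> tower N (corner w)" using N K(2) same by (metis subset_iff)
    then show ?thesis by (rule that)
  qed (use that in auto)
qed

lemma tower_mono: 
  assumes "n \<le> k"
  shows "tower n (corner w) \<subseteq> tower k (corner w)"
proof -
  have "(2::real) powi int (4 * Suc n) \<le> 2 powi int (4 * Suc k)"
    unfolding power_int_of_nat using assms by (intro power_increasing) auto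
  moreover have "exp (- real (Suc k)) \<le> exp (- real (Suc n))" "exp (real (Suc n)) \<le> exp (real (Suc k))"
    using assms by simp_all
  ultimately have "{exp (- real (Suc n))..exp (real (Suc n))} \<subseteq> {exp (- real (Suc k))..exp (real (Suc k))}"
    and scale: "- ((2::real) powi int (4 * Suc k)) \<le> - (2 powi int (4 * Suc n))"
    by (simp_all only: atLeastatMost_subset_iff neg_le_iff_le) simp
  moreover have "x \<in> dyadic_cube (int (4 * Suc k)) (corner w)"
    if x: "x \<in> dyadic_cube (int (4 * Suc n)) (corner w)" for x
    unfolding dyadic_cube_def mem_Collect_eq
  proof
    fix i
    have "of_int (corner w $ i) * 2 powi int (4 * Suc n) \<le> x $ i"
      "x $ i < (of_int (corner w $ i) + 1) * 2 powi int (4 * Suc n)"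
      using x by (auto simp: dyadic_cube_def)
    then show "of_int (corner w $ i) * 2 powi int (4 * Suc k) \<le> x $ i
        \<and> x $ i < (of_int (corner w $ i) + 1) * 2 powi int (4 * Suc k)"
      using scale by (cases "0 \<le> fst w $ i") (simp_all only: corner_def vec_lambda_beta if_True if_False, auto)
  qed
  ultimately show ?thesis
    unfolding tower_def by (intro Sigma_mono) auto
qed

lemma tower_sets [measurable]: "tower n c \<in> sets rho"
  by (rule CZ_sets_rho[OF tower_CZ])

text \<open>The layers between consecutive towers. Over all levels and orthants they partition the half-space.\<close>

definition annulus :: "nat \<Rightarrow> int ^ 'n \<Rightarrow> ((real ^ 'n) \<times> real) set" where
  "annulus n c = disjointed (\<lambda>k. tower k c) n"

lemma annulus_sets [measurable]: "annulus n c \<in> sets rho"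
  unfolding annulus_def disjointed_def by (intro sets.Diff sets.finite_UN tower_sets) auto

lemma annulus_subset_tower: "annulus n c \<subseteq> tower n c"
  unfolding annulus_def by (rule disjointed_subset)

lemma annulus_finite: "emeasure rho (annulus n c) < \<infinity>"
  using emeasure_mono[OF annulus_subset_tower tower_sets] CZ_finite[OF tower_CZ]
  by (rule le_less_trans)

text \<open>The orthant and the level of a layer can be read off from each of its points.\<close>

lemma annulus_eq:
  assumes "z \<in> annulus n (corner w)"
  shows "corner z = corner w" "(LEAST k. z \<in> tower k (corner z)) = n"
proof -
  have least: "z \<notin> tower k (corner w)" if "k < n" for k
    using assms that by (simp_all add: annulus_def disjointed_def)
  have tower: "z \<in> tower n (corner w)" using assms annulus_subset_tower by blast
  show c: "corner z = corner w" using corner_tower[OF tower] .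
  have "(LEAST k. z \<in> tower k (corner w)) = n"
    by (rule Least_equality[where P = "\<lambda>k. z \<in> tower k (corner w)", OF tower]) (metis least leI)
  then show "(LEAST k. z \<in> tower k (corner z)) = n" by (simp only: c)
qed

lemma UN_disjointed_tower:
  "(\<Union>n\<in>{0..<Suc N}. disjointed (\<lambda>n. tower n (corner w)) n) = tower N (corner w)"
proof -
  have "(\<Union>n\<in>{0..<Suc N}. tower n (corner w)) = tower N (corner w)"
  proof
    show "(\<Union>n\<in>{0..<Suc N}. tower n (corner w)) \<subseteq> tower N (corner w)"
      by (intro UN_least tower_mono) simp
  qed (rule UN_upper, simp)
  then show ?thesis by (simp only: finite_UN_disjointed_eq)
qed

text \<open>Pointwise form of the partition of a tower into the annuli up to its level.\<close>

lemma indicator_tower_eq_sum: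
  "indicator (tower N (corner w)) z = (\<Sum>n<Suc N. indicator (annulus n (corner w)) z :: real)"
proof -
  have "disjoint_family (\<lambda>n. annulus n (corner w))"
    unfolding annulus_def by (rule disjoint_family_disjointed)
  then have "disjoint_family_on (\<lambda>n. annulus n (corner w)) {0..<Suc N}"
    by (rule disjoint_family_on_mono[rotated]) simp
  then have "indicator (\<Union>n\<in>{0..<Suc N}. annulus n (corner w)) z
      = (\<Sum>n\<in>{0..<Suc N}. indicator (annulus n (corner w)) z :: real)"
    by (intro indicator_UN_disjoint) simp_all
  then show ?thesis
    unfolding annulus_def UN_disjointed_tower lessThan_atLeast0 .
qed

lemma finite_range_corner: "finite (range (corner :: (real ^ 'n) \<times> real \<Rightarrow> int ^ 'n))"
proof (rule finite_subset)
  show "range (corner :: (real ^ 'n) \<times> real \<Rightarrow> int ^ 'n)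
      \<subseteq> (\<lambda>S. \<chi> i. if i \<in> S then 0 else - 1) ` (UNIV :: 'n set set)"
  proof
    fix c :: "int ^ 'n" assume "c \<in> range corner"
    then obtain z :: "(real ^ 'n) \<times> real" where "c = corner z" by blast
    then have "c = (\<lambda>S. \<chi> i. if i \<in> S then 0 else - 1) {i. fst z $ i \<ge> 0}" by (simp add: corner_def)
    then show "c \<in> (\<lambda>S. \<chi> i. if i \<in> S then 0 else - 1) ` (UNIV :: 'n set set)"
      by (rule image_eqI) simp
  qed
qed simp

lemma corner_measurable [measurable]: "corner \<in> rho \<rightarrow>\<^sub>M count_space UNIV"
proof (subst measurable_count_space_eq2_countable, safe)
  fix c :: "int ^ 'n"
  have eq: "corner z = c \<longleftrightarrow> (\<forall>i. 0 \<le> fst z $ i \<and> c $ i = 0 \<or> fst z $ i < 0 \<and> c $ i = - 1)" for z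
    unfolding corner_def vec_eq_iff vec_lambda_beta by (intro iff_allI) auto
  have "Measurable.pred borel (\<lambda>z :: (real ^ 'n) \<times> real. corner z = c)"
    unfolding eq by measurable
  then have "Measurable.pred rho (\<lambda>z. corner z = c)" by (rule measurable_rho)
  then have "{z \<in> space rho. corner z = c} \<in> sets rho" by measurable
  also have "{z \<in> space rho. corner z = c} = corner -` {c} \<inter> space rho" by auto
  finally show "corner -` {c} \<inter> space rho \<in> sets rho" .
qed auto

text \<open>Each point of the half-space uses the function of its own annulus; measurability is preserved because
  there are only countably many annuli.\<close>

lemma glue_measurable:
  fixes F :: "nat \<Rightarrow> int ^ 'n \<Rightarrow> (real ^ 'n) \<times> real \<Rightarrow> complex"
  assumes "\<And>n c. F n c \<in> borel_measurable rho"
  shows "(\<lambda>z. F (LEAST n. z \<in> tower n (corner z)) (corner z) z) \<in> borel_measurable rho"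
proof -
  have "Measurable.pred rho (\<lambda>z. z \<in> tower n (corner z))" for n
    by (rule measurable_compose_countable[of "\<lambda>c z. z \<in> tower n c", OF _ corner_measurable]) measurable
  then have level: "(\<lambda>z. LEAST n. z \<in> tower n (corner z)) \<in> rho \<rightarrow>\<^sub>M count_space UNIV"
    by (rule measurable_Least)
  have "(\<lambda>z. F n (corner z) z) \<in> borel_measurable rho" for n
    by (rule measurable_compose_countable[of "F n", OF assms corner_measurable])
  then show ?thesis by (rule measurable_compose_countable[OF _ level])
qed

section \<open>Pairing atoms with functions of bounded mean oscillation\<close>

lemma L2_iff: "f \<in> L2 \<longleftrightarrow> sq_integrable rho f"
  by (simp add: L2_def sq_integrable_def)

text \<open>Calderon--Zygmund sets are not compact, but they are contained in compact subsets of the half-space.\<close>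

lemma L2_loc_CZ:
  assumes "f \<in> L2_loc" "R \<in> CZ_sets"
  shows "sq_integrable rho (\<lambda>z. indicator R z *\<^sub>R f z)"
proof -
  have [measurable]: "f \<in> borel_measurable rho" using assms by (simp add: L2_loc_def)
  have [measurable]: "R \<in> sets rho" by (rule CZ_sets_rho) fact
  obtain K where K: "compact K" "R \<subseteq> K" "K \<subseteq> AxB" by (rule CZ_subset_compact[OF assms(2)])
  have [measurable]: "K \<in> sets rho" using K by (intro compact_sets_rho)
  have "integrable rho (\<lambda>z. indicator K z *\<^sub>R (cmod (f z))\<^sup>2)"
    using assms(1) K by (auto simp: L2_loc_def set_integrable_def)
  moreover have "(norm (indicator K z *\<^sub>R f z))\<^sup>2 = indicator K z *\<^sub>R (cmod (f z))\<^sup>2" for z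
    by (simp add: indicator_def)
  ultimately have "sq_integrable rho (\<lambda>z. indicator K z *\<^sub>R f z)"
    by (simp add: sq_integrable_def)
  then show ?thesis
    by (rule sq_integrable_bound) (use K in \<open>auto simp: indicator_def\<close>)
qed

lemma sq_integrable_deviation:
  assumes "f \<in> L2_loc" "R \<in> CZ_sets"
  shows "sq_integrable rho (\<lambda>z. indicator R z *\<^sub>R (f z - c))"
proof -
  have "sq_integrable rho (\<lambda>z. indicator R z *\<^sub>R f z - indicator R z *\<^sub>R c)"
    using assms by (intro sq_integrable_diff L2_loc_CZ sq_integrable_indicator CZ_sets_rho CZ_finite)
  then show ?thesis by (simp add: scaleR_diff_right)
qed

lemma oscillation_eq:
  "oscillation f R = L2_norm (\<lambda>z. indicator R z *\<^sub>R (f z - mean_value f R)) / sqrt (measure rho R)"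
proof -
  have "(cmod (indicator R z *\<^sub>R (f z - mean_value f R)))\<^sup>2
      = indicator R z *\<^sub>R (cmod (f z - mean_value f R))\<^sup>2" for z
    by (simp add: indicator_def)
  then show ?thesis
    by (simp only: oscillation_def L2_norm_def set_lebesgue_integral_def real_sqrt_divide)
qed

lemma oscillation_nonneg: "oscillation f R \<ge> 0"
  by (simp add: oscillation_eq L2_norm_def)

lemma oscillation_le_BMO2_norm: "f \<in> BMO2 \<Longrightarrow> R \<in> CZ_sets \<Longrightarrow> oscillation f R \<le> BMO2_norm f"
  by (simp add: BMO2_norm_def BMO2_def cSUP_upper)

lemma powr_minus_half: "x > 0 \<Longrightarrow> x powr (- (1 / 2)) = 1 / sqrt x" for x :: real
  by (simp add: powr_minus_divide powr_half_sqrt)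

lemma atomE:
  assumes "atom b"
  obtains R where "R \<in> CZ_sets" "sq_integrable rho b" "integrable rho b"
    "AE z in rho. z \<notin> R \<longrightarrow> b z = 0" "L2_norm b \<le> 1 / sqrt (measure rho R)" "(LINT z|rho. b z) = 0"
proof -
  obtain R where R: "R \<in> CZ_sets" "AE z in rho. z \<notin> R \<longrightarrow> b z = 0"
    "L2_norm b \<le> measure rho R powr (- 1 / 2)" and b: "sq_integrable rho b" "(LINT z|rho. b z) = 0"
    using assms by (auto simp: atom_def L2_iff)
  show ?thesis
    by (rule that[OF R(1) b(1) _ R(2) _ b(2)])
      (use R b CZ_pos[OF R(1)] in \<open>auto simp: powr_minus_half intro: integrable_of_support CZ_sets_rho CZ_finite\<close>)
qed

lemma atom_integrable: "atom b \<Longrightarrow> integrable rho b"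
  by (rule atomE)

lemma atomI:
  assumes "R \<in> CZ_sets" "sq_integrable rho b" "AE z in rho. z \<notin> R \<longrightarrow> b z = 0"
    "L2_norm b \<le> 1 / sqrt (measure rho R)" "(LINT z|rho. b z) = 0"
  shows "atom b"
  using assms CZ_pos[OF assms(1)] by (auto simp: atom_def L2_iff powr_minus_half)

lemma atom_zero: "atom (\<lambda>_. 0)"
  by (rule atomI[OF tower_CZ[of 0 0]]) (auto simp: sq_integrable_def L2_norm_def)

text \<open>The constant \<open>P (mean_value f R)\<close> may be subtracted from \<open>P \<circ> f\<close> because the atom has integral zero. As \<open>P\<close> is
  1-Lipschitz, the difference is dominated by the deviation of \<open>f\<close> itself from its mean, so that the mean of
  \<open>P \<circ> f\<close> never enters. The map \<open>P\<close> is used as the identity and as a truncation.\<close>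

lemma atom_pairing_bound:
  fixes P :: "complex \<Rightarrow> complex"
  assumes f: "f \<in> BMO2" and b: "atom b" and P: "P \<in> borel_measurable borel"
    and lip: "\<And>u v. cmod (P u - P v) \<le> cmod (u - v)"
  shows "integrable rho (\<lambda>z. P (f z) * b z)"
    and "cmod (LINT z|rho. P (f z) * b z) \<le> BMO2_norm f"
proof -
  obtain R where R: "R \<in> CZ_sets" and b2: "sq_integrable rho b" and bi: "integrable rho b"
    and supp: "AE z in rho. z \<notin> R \<longrightarrow> b z = 0"
    and bn: "L2_norm b \<le> 1 / sqrt (measure rho R)" and b0: "(LINT z|rho. b z) = 0"
    by (rule atomE[OF b])
  have loc: "f \<in> L2_loc" using f by (simp add: BMO2_def)
  have [measurable]: "f \<in> borel_measurable rho" "P \<in> borel_measurable borel" "R \<in> sets rho"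
    "b \<in> borel_measurable rho"
    using loc P CZ_sets_rho[OF R] b2 by (auto simp: L2_loc_def sq_integrable_def)
  define m where "m = mean_value f R"
  define F where "F = (\<lambda>z. indicator R z *\<^sub>R (f z - m))"
  define G where "G z = indicator R z *\<^sub>R (P (f z) - P m)" for z
  have F: "sq_integrable rho F" unfolding F_def by (rule sq_integrable_deviation[OF loc R])
  have GF: "cmod (G z) \<le> cmod (F z)" for z
    using lip[of "f z" m] by (simp add: F_def G_def indicator_def)
  have G: "sq_integrable rho G"
  proof (rule sq_integrable_bound[OF F])
    show "G \<in> borel_measurable rho" unfolding G_def by measurable
  qed (simp add: GF)
  have eq: "AE z in rho. G z * b z + P m * b z = P (f z) * b z"
    using supp by eventually_elim (auto simp: G_def indicator_def algebra_simps)
  have int: "integrable rho (\<lambda>z. G z * b z)" by (rule sq_integrable_times[OF G b2])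
  then have "integrable rho (\<lambda>z. G z * b z + P m * b z)" using bi by auto
  then show "integrable rho (\<lambda>z. P (f z) * b z)"
    by (rule integrable_cong_AE_imp) (use eq in \<open>auto simp: eq_commute\<close>)
  have "(LINT z|rho. P (f z) * b z) = (LINT z|rho. G z * b z + P m * b z)"
    by (rule integral_cong_AE) (use eq G in \<open>auto simp: sq_integrable_def eq_commute\<close>)
  also have "\<dots> = (LINT z|rho. G z * b z)" using int bi b0 by simp
  also have "cmod \<dots> \<le> (LINT z|rho. cmod (G z) * cmod (b z))"
    using integral_norm_bound[of rho "\<lambda>z. G z * b z"] by (simp only: norm_mult)
  also have "\<dots> \<le> L2_norm G * L2_norm b"
    unfolding L2_norm_def by (rule integral_Cauchy_Schwarz[OF G b2])
  also have "\<dots> \<le> L2_norm F * (1 / sqrt (measure rho R))"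
  proof (rule mult_mono)
    show "L2_norm G \<le> L2_norm F"
      unfolding L2_norm_def using F G GF
      by (intro real_sqrt_le_mono integral_mono) (auto simp: sq_integrable_def power_mono)
  qed (use bn in \<open>auto simp: L2_norm_def\<close>)
  also have "\<dots> = oscillation f R" by (simp add: oscillation_eq F_def m_def)
  also have "\<dots> \<le> BMO2_norm f" by (rule oscillation_le_BMO2_norm[OF f R])
  finally show "cmod (LINT z|rho. P (f z) * b z) \<le> BMO2_norm f" .
qed

text \<open>A bounded function defines a continuous functional on \<open>L\<^sup>1\<close>, the space in which the decomposition converges.\<close>

lemma decomposition_pairing:
  fixes g :: "(real ^ 'n) \<times> real \<Rightarrow> complex"
  assumes h: "integrable rho h" "atomic_decomposition h c b"
    and g: "g \<in> borel_measurable rho" "\<And>z. cmod (g z) \<le> B"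
  shows "(\<lambda>j. c j * (LINT z|rho. g z * b j z)) sums (LINT z|rho. g z * h z)"
proof -
  have bi: "integrable rho (b j)" for j using h(2) by (simp add: atomic_decomposition_def atom_integrable)
  note [measurable] = g(1)
  have gi: "integrable rho (\<lambda>z. g z * u z)" if "integrable rho u" for u
  proof (rule Bochner_Integration.integrable_bound)
    show "integrable rho (\<lambda>z. B * cmod (u z))" using that by auto
    show "(\<lambda>z. g z * u z) \<in> borel_measurable rho" using that by measurable
    show "AE z in rho. norm (g z * u z) \<le> norm (B * cmod (u z))"
      using g(2) by (auto simp: norm_mult intro!: mult_right_mono order_trans[OF _ abs_ge_self])
  qed
  let ?S = "\<lambda>N z. \<Sum>j<N. c j * b j z"
  have Si: "integrable rho (?S N)" for N using bi by auto
  have partial: "(\<Sum>j<N. c j * (LINT z|rho. g z * b j z)) = (LINT z|rho. g z * ?S N z)" for N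
  proof -
    have "(LINT z|rho. g z * ?S N z) = (LINT z|rho. (\<Sum>j<N. c j * (g z * b j z)))"
      by (simp add: sum_distrib_left mult_ac)
    also have "\<dots> = (\<Sum>j<N. c j * (LINT z|rho. g z * b j z))"
      using gi[OF bi] by (subst Bochner_Integration.integral_sum) auto
    finally show ?thesis by simp
  qed
  have factor: "cmod (a * u - a * v) = cmod a * cmod (v - u)" for a u v
    by (metis norm_minus_commute norm_mult right_diff_distrib)
  have close: "cmod ((\<Sum>j<N. c j * (LINT z|rho. g z * b j z)) - (LINT z|rho. g z * h z))
      \<le> B * (LINT z|rho. cmod (h z - ?S N z))" for N
  proof -
    have "(\<Sum>j<N. c j * (LINT z|rho. g z * b j z)) - (LINT z|rho. g z * h z)
        = (LINT z|rho. g z * ?S N z - g z * h z)"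
      unfolding partial using gi[OF Si] gi[OF h(1)] by simp
    also have "cmod \<dots> \<le> (LINT z|rho. cmod (g z * ?S N z - g z * h z))"
      by (rule integral_norm_bound)
    also have "\<dots> \<le> (LINT z|rho. B * cmod (h z - ?S N z))"
    proof (rule integral_mono)
      show "integrable rho (\<lambda>z. cmod (g z * ?S N z - g z * h z))"
        by (rule integrable_norm[OF Bochner_Integration.integrable_diff[OF gi[OF Si] gi[OF h(1)]]])
      show "integrable rho (\<lambda>z. B * cmod (h z - ?S N z))"
        by (rule integrable_mult_right[OF integrable_norm[OF Bochner_Integration.integrable_diff[OF h(1) Si]]])
      fix z
      have "cmod (g z * ?S N z - g z * h z) = cmod (g z) * cmod (h z - ?S N z)"
        by (rule factor)
      also have "\<dots> \<le> B * cmod (h z - ?S N z)" using g(2) by (intro mult_right_mono) auto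
      finally show "cmod (g z * ?S N z - g z * h z) \<le> B * cmod (h z - ?S N z)" .
    qed
    finally show ?thesis by simp
  qed
  have "(\<lambda>N. LINT z|rho. cmod (h z - ?S N z)) \<longlonglongrightarrow> 0"
    using h(2) by (simp only: atomic_decomposition_def)
  then have "(\<lambda>N. B * (LINT z|rho. cmod (h z - ?S N z))) \<longlonglongrightarrow> 0"
    by (rule tendsto_mult_right_zero)
  then have "(\<lambda>N. (\<Sum>j<N. c j * (LINT z|rho. g z * b j z)) - (LINT z|rho. g z * h z)) \<longlonglongrightarrow> 0"
    by (rule Lim_null_comparison[OF always_eventually[OF allI[OF close]]])
  then show ?thesis
    unfolding sums_def by (rule LIM_zero_cancel)
qed

section \<open>The functional defined by a function of bounded mean oscillation\<close>

text \<open>Projection onto a disc keeps the truncation 1-Lipschitz on the complex plane.\<close>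

definition trunc :: "nat \<Rightarrow> complex \<Rightarrow> complex" where
  "trunc N = closest_point (cball 0 (real N))"

lemma trunc_lipschitz: "cmod (trunc N u - trunc N v) \<le> cmod (u - v)"
  using closest_point_lipschitz[of "cball 0 (real N)" u v] by (simp add: trunc_def dist_norm)

lemma trunc_measurable [measurable]: "trunc N \<in> borel_measurable borel"
  unfolding trunc_def by (intro borel_measurable_continuous_onI continuous_on_closest_point) auto

lemma trunc_bound: "cmod (trunc N u) \<le> real N"
  using closest_point_in_set[of "cball 0 (real N)" u] by (simp add: trunc_def)

lemma trunc_le: "cmod (trunc N u) \<le> cmod u"
proof -
  have "trunc N 0 = 0" by (simp add: trunc_def closest_point_self)
  then show ?thesis using trunc_lipschitz[of N u 0] by simp
qed

lemma trunc_tendsto: "(\<lambda>N. trunc N u) \<longlonglongrightarrow> u"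
proof (rule tendsto_eventually)
  obtain N where N: "cmod u \<le> real N" using real_arch_simple by blast
  have "trunc n u = u" if "N \<le> n" for n
    unfolding trunc_def by (rule closest_point_self) (use that N in auto)
  then show "\<forall>\<^sub>F n in sequentially. trunc n u = u" by (auto simp: eventually_sequentially)
qed

lemma trunc_pairing_tendsto:
  assumes f: "f \<in> borel_measurable rho" and h: "h \<in> borel_measurable rho"
    and int: "integrable rho (\<lambda>z. f z * h z)"
  shows "(\<lambda>N. LINT z|rho. trunc N (f z) * h z) \<longlonglongrightarrow> (LINT z|rho. f z * h z)"
proof (rule integral_dominated_convergence)
  note [measurable] = f h
  show "(\<lambda>z. f z * h z) \<in> borel_measurable rho" by measurable
  show "(\<lambda>z. trunc N (f z) * h z) \<in> borel_measurable rho" for N by measurable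
  show "integrable rho (\<lambda>z. cmod (f z * h z))" using int by auto
  show "AE z in rho. (\<lambda>N. trunc N (f z) * h z) \<longlonglongrightarrow> f z * h z"
    by (intro AE_I2 tendsto_intros trunc_tendsto)
  show "AE z in rho. norm (trunc N (f z) * h z) \<le> cmod (f z * h z)" for N
    by (intro AE_I2) (simp add: norm_mult trunc_le mult_right_mono)
qed

lemma BMO2_norm_nonneg:
  assumes "f \<in> (BMO2 :: ((real ^ 'n) \<times> real \<Rightarrow> complex) set)"
  shows "BMO2_norm f \<ge> 0"
  using oscillation_le_BMO2_norm[OF assms tower_CZ[of 0 0]] oscillation_nonneg[of f "tower 0 0"]
  by linarith

text \<open>Each term of the decomposition converges by dominated convergence and is bounded by
  \<open>BMO2_norm f * cmod (c j)\<close> uniformly in the truncation level, so Tannery's theorem interchanges the limit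
  with the sum. The limit on the left is manifestly independent of the decomposition.\<close>

lemma trunc_pairing_decomposition:
  assumes f: "f \<in> BMO2" and h: "integrable rho h" and d: "atomic_decomposition h c b"
  shows "(\<lambda>N. LINT z|rho. trunc N (f z) * h z) \<longlonglongrightarrow> (\<Sum>j. c j * (LINT z|rho. f z * b j z))"
    and "cmod (LINT z|rho. trunc N (f z) * h z) \<le> BMO2_norm f * (\<Sum>j. cmod (c j))"
proof -
  have fm [measurable]: "f \<in> borel_measurable rho" using f by (simp add: BMO2_def L2_loc_def)
  have b: "atom (b j)" for j using d by (simp add: atomic_decomposition_def)
  have c: "summable (\<lambda>j. cmod (c j))" using d by (simp add: atomic_decomposition_def)
  have sums: "(\<lambda>j. c j * (LINT z|rho. trunc N (f z) * b j z)) sums (LINT z|rho. trunc N (f z) * h z)" for N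
    by (rule decomposition_pairing[OF h d, where B = "real N"]) (auto simp: trunc_bound)
  have term_bound: "norm (c j * (LINT z|rho. trunc N (f z) * b j z)) \<le> BMO2_norm f * cmod (c j)" for j N
    unfolding norm_mult mult.commute[of "BMO2_norm f"]
    by (intro mult_left_mono atom_pairing_bound(2)[OF f b trunc_measurable trunc_lipschitz] norm_ge_zero)
  have dom: "summable (\<lambda>j. BMO2_norm f * cmod (c j))" using c by (rule summable_mult)
  have lim: "(\<lambda>N. c j * (LINT z|rho. trunc N (f z) * b j z)) \<longlonglongrightarrow> c j * (LINT z|rho. f z * b j z)" for j
  proof (intro tendsto_mult tendsto_const trunc_pairing_tendsto fm)
    show "b j \<in> borel_measurable rho"
      by (rule borel_measurable_integrable[OF atom_integrable[OF b]])
    show "integrable rho (\<lambda>z. f z * b j z)"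
      using atom_pairing_bound(1)[OF f b[of j], of id] by simp
  qed
  define A where "A j N = c j * (LINT z|rho. trunc N (f z) * b j z)" for j N
  define L where "L j = c j * (LINT z|rho. f z * b j z)" for j
  have "\<forall>\<^sub>F (j, N) in at_top \<times>\<^sub>F sequentially. norm (A j N) \<le> BMO2_norm f * cmod (c j)"
    unfolding A_def by (rule always_eventually) (simp only: split_paired_All split_conv term_bound simp_thms)
  with lim have "(\<lambda>N. \<Sum>j. A j N) \<longlonglongrightarrow> (\<Sum>j. L j)"
    unfolding A_def[symmetric] L_def[symmetric]
    using tannerys_theorem[of A L sequentially, OF _ _ dom sequentially_bot] by blast
  then have "(\<lambda>N. \<Sum>j. c j * (LINT z|rho. trunc N (f z) * b j z)) \<longlonglongrightarrow> (\<Sum>j. c j * (LINT z|rho. f z * b j z))"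
    unfolding A_def L_def .
  then show "(\<lambda>N. LINT z|rho. trunc N (f z) * h z) \<longlonglongrightarrow> (\<Sum>j. c j * (LINT z|rho. f z * b j z))"
    by (simp only: sums_unique[OF sums, symmetric])
  have "norm (\<Sum>j. c j * (LINT z|rho. trunc N (f z) * b j z)) \<le> (\<Sum>j. BMO2_norm f * cmod (c j))"
    by (rule norm_suminf_le[OF term_bound dom])
  then show "cmod (LINT z|rho. trunc N (f z) * h z) \<le> BMO2_norm f * (\<Sum>j. cmod (c j))"
    by (simp only: sums_unique[OF sums, symmetric] suminf_mult[OF c])
qed

lemma H12_finE:
  assumes "h \<in> H12_fin"
  obtains N :: nat and c b where "h = (\<lambda>z. \<Sum>j<N. c j * b j z)" "\<forall>j<N. atom (b j)"
  using assms unfolding H12_fin_def mem_Collect_eq by (elim exE conjE) (rule that; assumption)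

text \<open>A finite combination is padded to a series by zero coefficients and the zero atom.\<close>

lemma H12_fin_subset_H12: "H12_fin \<subseteq> H12"
proof
  fix h assume "h \<in> (H12_fin :: ((real ^ 'n) \<times> real \<Rightarrow> complex) set)"
  then obtain N :: nat and c b where h: "h = (\<lambda>z. \<Sum>j<N. c j * b j z)" and b: "\<forall>j<N. atom (b j)"
    by (rule H12_finE)
  define c' where "c' j = (if j < N then c j else 0)" for j
  define b' where "b' j = (if j < N then b j else (\<lambda>_. 0))" for j
  have "(\<Sum>j<k. c' j * b' j z) = h z" if "N \<le> k" for k z
    unfolding h using that by (intro sum.mono_neutral_cong_right) (auto simp: c'_def b'_def)
  then have "\<forall>\<^sub>F k in sequentially. (LINT z|rho. cmod (h z - (\<Sum>j<k. c' j * b' j z))) = 0"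
    by (intro eventually_sequentiallyI[of N]) simp
  moreover have "summable (\<lambda>j. cmod (c' j))"
    by (rule summable_finite[of "{..<N}"]) (auto simp: c'_def)
  moreover have "atom (b' j)" for j using b by (simp add: b'_def atom_zero)
  ultimately have "atomic_decomposition h c' b'"
    by (simp add: atomic_decomposition_def tendsto_eventually)
  moreover have "integrable rho h" unfolding h using b
    by (intro Bochner_Integration.integrable_sum integrable_mult_right atom_integrable) simp
  ultimately show "h \<in> H12" by (auto simp: H12_def)
qed

lemma H12_norm_upper: "atomic_decomposition h c b \<Longrightarrow> H12_norm h \<le> (\<Sum>j. cmod (c j))"
  unfolding H12_norm_def
proof (rule cInf_lower)
  show "bdd_below {\<Sum>j. cmod (c j) |c b. atomic_decomposition h c b}"
    by (rule bdd_belowI[of _ 0]) (auto simp: atomic_decomposition_def intro!: suminf_nonneg)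
qed blast

lemma H12_norm_nonneg:
  assumes "h \<in> H12"
  shows "H12_norm h \<ge> 0"
  unfolding H12_norm_def
proof (rule cInf_greatest)
  show "{\<Sum>j. cmod (c j) |c b. atomic_decomposition h c b} \<noteq> {}"
    using assms unfolding H12_def by blast
qed (auto simp: atomic_decomposition_def intro!: suminf_nonneg)

text \<open>The form in which estimates over all decompositions pass to the infimum defining the norm.\<close>

lemma le_mult_H12_norm:
  assumes h: "h \<in> H12" and B: "B \<ge> 0"
    and le: "\<And>c b. atomic_decomposition h c b \<Longrightarrow> x \<le> B * (\<Sum>j. cmod (c j))"
  shows "x \<le> B * H12_norm h"
proof (cases "B = 0")
  case False
  with B have B: "B > 0" by simp
  have "x / B \<le> H12_norm h"
    unfolding H12_norm_def
  proof (rule cInf_greatest)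
    show "{\<Sum>j. cmod (c j) |c b. atomic_decomposition h c b} \<noteq> {}"
      using h unfolding H12_def by blast
    fix y assume "y \<in> {\<Sum>j. cmod (c j) |c b. atomic_decomposition h c b}"
    then obtain c b where "y = (\<Sum>j. cmod (c j))" "atomic_decomposition h c b" by blast
    with le[of c b] B show "x / B \<le> y" by (simp add: divide_le_eq mult.commute)
  qed
  with B show ?thesis by (simp add: divide_le_eq mult.commute)
next
  case True
  obtain c b where "atomic_decomposition h c b" using h unfolding H12_def by blast
  from le[OF this] True show ?thesis by simp
qed

lemma zero_in_H12: "(\<lambda>_. 0) \<in> H12"
proof (rule subsetD[OF H12_fin_subset_H12])
  show "(\<lambda>_. 0) \<in> H12_fin" unfolding H12_fin_def mem_Collect_eq
    by (intro exI[of _ 0] exI[of _ "\<lambda>_. 0"] exI[of _ "\<lambda>_ _. 0"]) simp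
qed

lemma H12_norm_zero: "H12_norm (\<lambda>_. 0) = 0"
proof (rule antisym)
  have "atomic_decomposition (\<lambda>_. 0) (\<lambda>_. 0) (\<lambda>_ _. 0)"
    by (simp add: atomic_decomposition_def atom_zero)
  from H12_norm_upper[OF this] show "H12_norm (\<lambda>_. 0) \<le> 0" by simp
qed (rule H12_norm_nonneg[OF zero_in_H12])

lemma BMO2_pairing_integrable:
  fixes f g :: "(real ^ 'n) \<times> real \<Rightarrow> complex"
  assumes f: "f \<in> BMO2" and g: "g \<in> H12_fin"
  shows "integrable rho (\<lambda>z. f z * g z)"
proof -
  obtain N :: nat and c b where g: "g = (\<lambda>z. \<Sum>j<N. c j * b j z)" and b: "\<forall>j<N. atom (b j)"
    using g by (rule H12_finE)
  have "integrable rho (\<lambda>z. \<Sum>j<N. c j * (id (f z) * b j z))"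
    using b by (intro Bochner_Integration.integrable_sum integrable_mult_right
        atom_pairing_bound(1)[OF f, of _ id]) auto
  then show ?thesis unfolding g by (simp add: sum_distrib_left mult_ac)
qed

text \<open>Defining the functional as a limit of pairings makes linearity immediate; no comparison of different
  decompositions of the same function occurs.\<close>

lemma BMO2_functional:
  fixes f :: "(real ^ 'n) \<times> real \<Rightarrow> complex"
  assumes f: "f \<in> BMO2"
  obtains l :: "((real ^ 'n) \<times> real \<Rightarrow> complex) \<Rightarrow> complex"
  where "l \<in> H12_dual" "\<And>g. g \<in> H12_fin \<Longrightarrow> l g = (LINT z|rho. f z * g z)"
    "H12_dual_norm l \<le> BMO2_norm f"
proof -
  \<comment> \<open>A formula that makes sense for all functions; on \<open>H12\<close> the limit exists.\<close>
  define l where "l h = lim (\<lambda>N. LINT z|rho. trunc N (f z) * h z)" for h :: "(real ^ 'n) \<times> real \<Rightarrow> complex"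
  have [measurable]: "f \<in> borel_measurable rho" using f by (simp add: BMO2_def L2_loc_def)
  have lim: "(\<lambda>N. LINT z|rho. trunc N (f z) * h z) \<longlonglongrightarrow> l h" if "h \<in> H12" for h
  proof -
    obtain c b where "integrable rho h" "atomic_decomposition h c b"
      using \<open>h \<in> H12\<close> unfolding H12_def by blast
    from trunc_pairing_decomposition(1)[OF f this] show ?thesis
      unfolding l_def by (simp only: limI)
  qed
  have int: "integrable rho (\<lambda>z. trunc N (f z) * h z)" if "h \<in> H12" for N h
  proof (rule Bochner_Integration.integrable_bound)
    have hi: "integrable rho h" using that by (simp add: H12_def)
    then show "integrable rho (\<lambda>z. real N * cmod (h z))" by auto
    show "(\<lambda>z. trunc N (f z) * h z) \<in> borel_measurable rho" using hi by measurable
    show "AE z in rho. norm (trunc N (f z) * h z) \<le> norm (real N * cmod (h z))"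
      by (simp add: norm_mult mult_right_mono trunc_bound)
  qed
  have bound: "cmod (l h) \<le> BMO2_norm f * H12_norm h" if h: "h \<in> H12" for h
  proof (rule le_mult_H12_norm[OF h BMO2_norm_nonneg[OF f]])
    fix c b assume d: "atomic_decomposition h c b"
    have hi: "integrable rho h" using h by (simp add: H12_def)
    show "cmod (l h) \<le> BMO2_norm f * (\<Sum>j. cmod (c j))"
      by (rule LIMSEQ_le_const2[OF tendsto_norm[OF lim[OF h]]])
        (auto intro: trunc_pairing_decomposition(2)[OF f hi d])
  qed
  have "l \<in> H12_dual"
    unfolding H12_dual_def mem_Collect_eq
  proof (intro conjI ballI allI)
    fix g h :: "(real ^ 'n) \<times> real \<Rightarrow> complex" assume g: "g \<in> H12" and h: "h \<in> H12"
    have "(\<lambda>N. LINT z|rho. trunc N (f z) * (g z + h z)) \<longlonglongrightarrow> l g + l h"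
      using tendsto_add[OF lim[OF g] lim[OF h]] int[OF g] int[OF h] by (simp add: distrib_left)
    then show "l (\<lambda>z. g z + h z) = l g + l h" unfolding l_def by (rule limI)
  next
    fix c and g :: "(real ^ 'n) \<times> real \<Rightarrow> complex" assume g: "g \<in> H12"
    have "(\<lambda>N. LINT z|rho. trunc N (f z) * (c * g z)) \<longlonglongrightarrow> c * l g"
      using tendsto_mult[OF tendsto_const lim[OF g], of c] by (simp add: mult.left_commute)
    then show "l (\<lambda>z. c * g z) = c * l g" unfolding l_def by (rule limI)
  next
    show "\<exists>B. \<forall>g\<in>H12. cmod (l g) \<le> B * H12_norm g" using bound by blast
  qed
  moreover have "l g = (LINT z|rho. f z * g z)" if g: "g \<in> H12_fin" for g :: "(real ^ 'n) \<times> real \<Rightarrow> complex"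
  proof -
    have "g \<in> H12" using g H12_fin_subset_H12 by blast
    then have "g \<in> borel_measurable rho" by (auto simp: H12_def)
    then show ?thesis
      unfolding l_def by (intro limI trunc_pairing_tendsto BMO2_pairing_integrable[OF f g]) measurable
  qed
  moreover have "H12_dual_norm l \<le> BMO2_norm f"
    unfolding H12_dual_norm_def
  proof (rule cSUP_least)
    have "(\<lambda>_. 0) \<in> {g \<in> (H12 :: ((real ^ 'n) \<times> real \<Rightarrow> complex) set). H12_norm g \<le> 1}"
      by (simp add: zero_in_H12 H12_norm_zero)
    then show "{g \<in> (H12 :: ((real ^ 'n) \<times> real \<Rightarrow> complex) set). H12_norm g \<le> 1} \<noteq> {}"
      by blast
    fix g :: "(real ^ 'n) \<times> real \<Rightarrow> complex" assume "g \<in> {g \<in> H12. H12_norm g \<le> 1}"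
    then have g: "g \<in> H12" "H12_norm g \<le> 1" by auto
    have "cmod (l g) \<le> BMO2_norm f * H12_norm g" by (rule bound[OF g(1)])
    also have "\<dots> \<le> BMO2_norm f * 1" by (rule mult_left_mono[OF g(2) BMO2_norm_nonneg[OF f]])
    finally show "cmod (l g) \<le> BMO2_norm f" by simp
  qed
  ultimately show ?thesis by (rule that)
qed

section \<open>Cancelling functions as multiples of atoms\<close>

text \<open>The functions that become atoms after scaling when \<open>R\<close> is a Calderon--Zygmund set.\<close>

definition cancelling :: "((real ^ 'n) \<times> real) set \<Rightarrow> ((real ^ 'n) \<times> real \<Rightarrow> complex) \<Rightarrow> bool" where
  "cancelling R g \<longleftrightarrow> sq_integrable rho g \<and> (AE z in rho. z \<notin> R \<longrightarrow> g z = 0) \<and> (LINT z|rho. g z) = 0"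

lemma cancelling_integrable: "R \<in> CZ_sets \<Longrightarrow> cancelling R g \<Longrightarrow> integrable rho g"
  by (auto simp: cancelling_def intro: integrable_of_support CZ_sets_rho CZ_finite)

lemma cancelling_add:
  assumes R: "R \<in> CZ_sets" and g: "cancelling R g" and h: "cancelling R h"
  shows "cancelling R (\<lambda>z. g z + h z)"
proof -
  have "AE z in rho. z \<notin> R \<longrightarrow> g z = 0" "AE z in rho. z \<notin> R \<longrightarrow> h z = 0"
    using g h by (simp_all add: cancelling_def)
  then have "AE z in rho. z \<notin> R \<longrightarrow> g z + h z = 0" by eventually_elim simp
  then show ?thesis
    using g h cancelling_integrable[OF R g] cancelling_integrable[OF R h]
    by (simp add: cancelling_def sq_integrable_add)
qed

lemma cancelling_mult: "cancelling R g \<Longrightarrow> cancelling R (\<lambda>z. c * g z)"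
  by (auto simp: cancelling_def sq_integrable_mult elim!: eventually_mono)

lemma cancelling_zero: "cancelling R (\<lambda>_. 0)"
  by (simp add: cancelling_def sq_integrable_def)

lemma cancelling_sum:
  fixes N :: nat
  assumes R: "R \<in> CZ_sets" and g: "\<And>n. cancelling R (g n)"
  shows "cancelling R (\<lambda>z. \<Sum>n<N. g n z)"
  by (induction N) (simp_all add: cancelling_zero cancelling_add[OF R _ g])

lemma cancelling_mono:
  assumes "cancelling R g" "R \<subseteq> S"
  shows "cancelling S g"
proof -
  have "AE z in rho. z \<notin> R \<longrightarrow> g z = 0" using assms(1) by (simp add: cancelling_def)
  then have "AE z in rho. z \<notin> S \<longrightarrow> g z = 0" by eventually_elim (use assms(2) in blast)
  then show ?thesis using assms(1) by (simp add: cancelling_def)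
qed

lemma atom_cancelling:
  assumes "atom b"
  obtains R where "R \<in> CZ_sets" "cancelling R b"
proof -
  obtain R where "R \<in> CZ_sets" "sq_integrable rho b" "AE z in rho. z \<notin> R \<longrightarrow> b z = 0"
    "(LINT z|rho. b z) = 0"
    using assms by (rule atomE)
  then show ?thesis by (intro that) (simp_all add: cancelling_def)
qed

text \<open>Any positive \<open>s\<close> not below the critical size \<open>\<rho>(R)\<^sup>1\<^sup>/\<^sup>2 \<parallel>g\<parallel>\<^sub>2\<close> is allowed, since the critical size itself may vanish.\<close>

lemma cancelling_atom:
  assumes R: "R \<in> CZ_sets" and g: "cancelling R g" and s: "s > 0" "sqrt (measure rho R) * L2_norm g \<le> s"
  shows "atom (\<lambda>z. of_real (1 / s) * g z)"
proof (rule atomI[OF R])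
  have c: "cancelling R (\<lambda>z. of_real (1 / s) * g z)" by (rule cancelling_mult[OF g])
  then show "sq_integrable rho (\<lambda>z. of_real (1 / s) * g z)"
    "AE z in rho. z \<notin> R \<longrightarrow> of_real (1 / s) * g z = 0" "(LINT z|rho. of_real (1 / s) * g z) = 0"
    unfolding cancelling_def by blast+
  have "L2_norm (\<lambda>z. of_real (1 / s) * g z) = L2_norm g / s"
    using s by (simp add: L2_norm_def norm_mult power_mult_distrib norm_divide power_divide real_sqrt_divide)
  also have "\<dots> \<le> 1 / sqrt (measure rho R)"
    using s CZ_pos[OF R] by (simp add: field_simps)
  finally show "L2_norm (\<lambda>z. of_real (1 / s) * g z) \<le> 1 / sqrt (measure rho R)" .
qed

lemma atom_decomposition:
  assumes "atom b"
  shows "atomic_decomposition b (\<lambda>j. if j = 0 then 1 else 0) (\<lambda>_. b)"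
proof -
  have "(\<Sum>j<k. (if j = 0 then 1 else 0) * b z) = b z" if "1 \<le> k" for k :: nat and z
  proof -
    have "(\<Sum>j<k. (if j = 0 then 1 else 0) * b z) = (\<Sum>j\<in>{0::nat}. (if j = 0 then 1 else 0) * b z)"
      by (rule sum.mono_neutral_right) (use that in auto)
    then show ?thesis by simp
  qed
  then have "\<forall>\<^sub>F k in sequentially. (LINT z|rho. cmod (b z - (\<Sum>j<k. (if j = 0 then 1 else 0) * b z))) = 0"
    by (intro eventually_sequentiallyI[of 1]) simp
  moreover have "summable (\<lambda>j::nat. cmod (if j = 0 then 1 else 0))"
    by (rule summable_finite[of "{0}"]) auto
  ultimately show ?thesis
    using assms by (simp add: atomic_decomposition_def tendsto_eventually)
qed

lemma atom_H12: "atom b \<Longrightarrow> b \<in> H12"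
  unfolding H12_def mem_Collect_eq
  by (intro conjI exI, erule atom_integrable, erule atom_decomposition)

lemma atom_H12_norm:
  assumes "atom b"
  shows "H12_norm b \<le> 1"
proof -
  have "(\<Sum>j::nat. cmod (if j = 0 then 1 else 0)) = (\<Sum>j\<in>{0}. cmod (if j = (0::nat) then 1 else 0))"
    by (rule suminf_finite) auto
  with H12_norm_upper[OF atom_decomposition[OF assms]] show ?thesis by simp
qed

lemma H12_finI: "\<forall>j<N. atom (b j) \<Longrightarrow> (\<lambda>z. \<Sum>j<N. c j * b j z) \<in> H12_fin" for N :: nat
  unfolding H12_fin_def mem_Collect_eq
  by (intro exI[of _ N] exI[of _ c] exI[of _ b] conjI refl)

text \<open>The function is a single scaled atom; one is added to the critical size to keep the scale positive.\<close>

lemma cancelling_H12: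
  assumes R: "R \<in> CZ_sets" and g: "cancelling R g"
  shows "g \<in> H12"
proof (rule subsetD[OF H12_fin_subset_H12])
  define s where "s = sqrt (measure rho R) * L2_norm g + 1"
  have "s > 0" unfolding s_def L2_norm_def by (intro add_nonneg_pos) auto
  then have "atom (\<lambda>z. of_real (1 / s) * g z)"
    by (intro cancelling_atom[OF R g]) (simp_all add: s_def)
  then have "(\<lambda>z. \<Sum>j<(1::nat). of_real s * (of_real (1 / s) * g z)) \<in> H12_fin"
    by (intro H12_finI[of 1 "\<lambda>_ z. of_real (1 / s) * g z" "\<lambda>_. of_real s"]) simp
  then show "g \<in> H12_fin" using \<open>s > 0\<close> by simp
qed

locale dual_functional =
  fixes l :: "((real ^ 'n) \<times> real \<Rightarrow> complex) \<Rightarrow> complex"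
  assumes dual: "l \<in> H12_dual"
begin

lemma l_add: "g \<in> H12 \<Longrightarrow> h \<in> H12 \<Longrightarrow> l (\<lambda>z. g z + h z) = l g + l h"
  using dual by (simp add: H12_dual_def)

lemma l_mult: "g \<in> H12 \<Longrightarrow> l (\<lambda>z. c * g z) = c * l g"
  using dual by (simp add: H12_dual_def)

lemma l_zero: "l (\<lambda>_. 0) = 0"
  using l_mult[OF zero_in_H12, of 0] by simp

lemma l_le_dual_norm:
  assumes "g \<in> H12" "H12_norm g \<le> 1"
  shows "cmod (l g) \<le> H12_dual_norm l"
  unfolding H12_dual_norm_def
proof (rule cSUP_upper)
  show "g \<in> {g \<in> H12. H12_norm g \<le> 1}" using assms by simp
  obtain B where B: "\<forall>g\<in>H12. cmod (l g) \<le> B * H12_norm g"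
    using dual unfolding H12_dual_def mem_Collect_eq by blast
  have "cmod (l h) \<le> \<bar>B\<bar>" if h: "h \<in> H12" "H12_norm h \<le> 1" for h
  proof -
    have "cmod (l h) \<le> B * H12_norm h" using B h by blast
    also have "\<dots> \<le> \<bar>B\<bar> * H12_norm h"
      using H12_norm_nonneg[OF h(1)] by (intro mult_right_mono) auto
    also have "\<dots> \<le> \<bar>B\<bar> * 1" using h(2) by (intro mult_left_mono) auto
    finally show ?thesis by simp
  qed
  then show "bdd_above ((\<lambda>g. cmod (l g)) ` {g \<in> H12. H12_norm g \<le> 1})"
    by (intro bdd_aboveI2[of _ _ "\<bar>B\<bar>"]) simp
qed

lemma dual_norm_nonneg: "H12_dual_norm l \<ge> 0"
  using l_le_dual_norm[OF zero_in_H12] by (simp add: H12_norm_zero l_zero)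

text \<open>
  The function \<open>g / s\<close> is an atom for every \<open>s\<close> slightly above \<open>\<rho>(R)\<^sup>1\<^sup>/\<^sup>2 \<parallel>g\<parallel>\<^sub>2\<close>; then \<open>s\<close> tends to this value.
\<close>

lemma l_cancelling_bound:
  assumes R: "R \<in> CZ_sets" and g: "cancelling R g"
  shows "cmod (l g) \<le> H12_dual_norm l * (sqrt (measure rho R) * L2_norm g)"
proof (rule field_le_epsilon)
  fix e :: real assume "e > 0"
  define D where "D = H12_dual_norm l"
  define t where "t = sqrt (measure rho R) * L2_norm g"
  \<comment> \<open>The increment is positive, also when \<open>D = 0\<close>, and costs less than \<open>e\<close> after multiplication by \<open>D\<close>.\<close>
  define s where "s = t + e / (D + 1)"
  have D: "D \<ge> 0" unfolding D_def by (rule dual_norm_nonneg)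
  have t: "t \<ge> 0" unfolding t_def L2_norm_def by simp
  have "e / (D + 1) > 0" using D \<open>e > 0\<close> by simp
  with t have s: "s > 0" "t \<le> s" unfolding s_def by linarith+
  define b where "b = (\<lambda>z. of_real (1 / s) * g z)"
  have b: "atom b" unfolding b_def using cancelling_atom[OF R g s(1)] s(2) by (simp add: t_def)
  have "g = (\<lambda>z. of_real s * b z)" using s(1) by (simp add: b_def fun_eq_iff)
  then have "l g = of_real s * l b" using l_mult[OF atom_H12[OF b], of "of_real s"] by simp
  then have "cmod (l g) = s * cmod (l b)" using s(1) by (simp add: norm_mult)
  also have "\<dots> \<le> s * D"
    using l_le_dual_norm[OF atom_H12[OF b] atom_H12_norm[OF b]] s(1) by (simp add: D_def)
  also have "\<dots> = D * t + e * (D / (D + 1))" by (simp add: s_def algebra_simps)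
  also have "\<dots> \<le> D * t + e * 1"
    using D \<open>e > 0\<close> by (intro add_left_mono mult_left_mono) auto
  finally show "cmod (l g) \<le> H12_dual_norm l * (sqrt (measure rho R) * L2_norm g) + e"
    by (simp add: D_def t_def)
qed

lemma l_sum:
  fixes N :: nat
  assumes R: "R \<in> CZ_sets" and g: "\<And>n. cancelling R (g n)"
  shows "l (\<lambda>z. \<Sum>n<N. g n z) = (\<Sum>n<N. l (g n))"
proof (induction N)
  case (Suc N)
  then show ?case
    using l_add[OF cancelling_H12[OF R cancelling_sum[OF R g]] cancelling_H12[OF R g]] by simp
qed (simp add: l_zero)

text \<open>The difference of the two functions is cancelling with \<open>L\<^sup>2\<close> norm zero.\<close>

lemma l_cong_AE:
  assumes R: "R \<in> CZ_sets" and g: "cancelling R g" and h: "cancelling R h"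
    and eq: "AE z in rho. g z = h z"
  shows "l g = l h"
proof -
  have d: "cancelling R (\<lambda>z. g z + (-1) * h z)"
    by (rule cancelling_add[OF R g cancelling_mult[OF h]])
  have "(LINT z|rho. (cmod (g z + (-1) * h z))\<^sup>2) = 0"
  proof (rule integral_eq_zero_AE)
    show "AE z in rho. (cmod (g z + (-1) * h z))\<^sup>2 = 0" using eq by eventually_elim simp
  qed
  then have "l (\<lambda>z. g z + (-1) * h z) = 0"
    using l_cancelling_bound[OF R d] by (simp add: L2_norm_def)
  moreover have "l (\<lambda>z. g z + (-1) * h z) = l g + (-1) * l h"
    using l_add[OF cancelling_H12[OF R g] cancelling_H12[OF R cancelling_mult[OF h]], of "-1"]
      l_mult[OF cancelling_H12[OF R h], of "-1"] by simp
  ultimately show ?thesis by simp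
qed

end

section \<open>The representer of a bounded functional\<close>

text \<open>A function of integral one, used to correct integrals. It does not depend on the level, so that the
  corrections on different annuli over the same orthant can cancel.\<close>

definition bump :: "int ^ 'n \<Rightarrow> (real ^ 'n) \<times> real \<Rightarrow> complex" where
  "bump c z = indicator (tower 0 c) z *\<^sub>R of_real (1 / measure rho (tower 0 c))"

text \<open>The part of \<open>g\<close> in an annulus, made to have integral zero by means of the bump. Over an orthant it is cancelling
  for every square integrable \<open>g\<close>, so a functional on \<open>H12\<close> can be applied to it.\<close>

definition recentre :: "nat \<Rightarrow> int ^ 'n \<Rightarrow> ((real ^ 'n) \<times> real \<Rightarrow> complex) \<Rightarrow> (real ^ 'n) \<times> real \<Rightarrow> complex" where
  "recentre n c g z = indicator (annulus n c) z *\<^sub>R g z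
     - (LINT w|rho. indicator (annulus n c) w *\<^sub>R g w) * bump c z"

lemma sq_integrable_bump: "sq_integrable rho (bump c)"
  unfolding bump_def[abs_def] by (intro sq_integrable_indicator tower_sets CZ_finite tower_CZ)

lemma bump_integral: "integrable rho (bump c)" "(LINT z|rho. bump c z) = 1"
  using integrable_indicator_scaleR[OF tower_sets CZ_finite[OF tower_CZ], of 0 c
      "of_real (1 / measure rho (tower 0 c)) :: complex"] CZ_pos[OF tower_CZ[of 0 c]]
  by (simp_all add: bump_def[abs_def] scaleR_conv_of_real del: of_real_divide flip: of_real_mult)

lemma integrable_annulus:
  fixes g :: "(real ^ 'n) \<times> real \<Rightarrow> complex"
  assumes "sq_integrable rho g"
  shows "integrable rho (\<lambda>z. indicator (annulus n c) z *\<^sub>R g z)"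
proof (rule integrable_of_support)
  show "sq_integrable rho (\<lambda>z. indicator (annulus n c) z *\<^sub>R g z)"
    by (rule sq_integrable_restrict[OF assms annulus_sets])
  show "AE z in rho. z \<notin> annulus n c \<longrightarrow> indicator (annulus n c) z *\<^sub>R g z = 0" by simp
qed (rule annulus_sets annulus_finite)+

lemma sq_integrable_recentre:
  assumes "sq_integrable rho g"
  shows "sq_integrable rho (recentre n c g)"
  unfolding recentre_def[abs_def]
  by (intro sq_integrable_diff sq_integrable_mult sq_integrable_bump sq_integrable_restrict assms annulus_sets)

lemma recentre_cancelling:
  assumes g: "sq_integrable rho g"
  shows "cancelling (tower n (corner w)) (recentre n (corner w) g)"
  unfolding cancelling_def
proof (intro conjI)
  let ?c = "corner w"
  show "sq_integrable rho (recentre n ?c g)" by (rule sq_integrable_recentre[OF g])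
  have "z \<notin> tower n ?c \<Longrightarrow> recentre n ?c g z = 0" for z
    using annulus_subset_tower[of n ?c] tower_mono[of 0 n w]
    by (auto simp: recentre_def bump_def indicator_def)
  then show "AE z in rho. z \<notin> tower n ?c \<longrightarrow> recentre n ?c g z = 0" by simp
  show "(LINT z|rho. recentre n ?c g z) = 0"
    using integrable_annulus[OF g, of n ?c] bump_integral[of ?c] by (simp add: recentre_def)
qed

lemma recentre_add:
  assumes "sq_integrable rho g" "sq_integrable rho h"
  shows "recentre n c (\<lambda>z. g z + h z) = (\<lambda>z. recentre n c g z + recentre n c h z)"
  using integrable_annulus[OF assms(1), of n c] integrable_annulus[OF assms(2), of n c]
  by (simp add: recentre_def fun_eq_iff scaleR_add_right algebra_simps)

lemma recentre_mult: "recentre n c (\<lambda>z. a * g z) = (\<lambda>z. a * recentre n c g z)"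
proof -
  have "indicator S z *\<^sub>R (a * g z) = a * (indicator S z *\<^sub>R g z)" for S z by simp
  then show ?thesis
    by (simp only: recentre_def fun_eq_iff Bochner_Integration.integral_mult_right_zero)
      (simp add: right_diff_distrib mult.assoc)
qed

text \<open>Hence a representer of \<open>g \<mapsto> l (recentre n c g)\<close> may be tested against restricted functions only, and its
  values outside the annulus do not enter.\<close>

lemma recentre_restrict:
  "recentre n c (\<lambda>z. indicator (annulus n c) z *\<^sub>R g z) = recentre n c g"
proof -
  have "indicator S z *\<^sub>R (indicator S z *\<^sub>R g z) = indicator S z *\<^sub>R g z" for S z
    by (simp add: indicator_def)
  then show ?thesis by (simp only: recentre_def fun_eq_iff simp_thms)
qed

text \<open>The coefficient of the bump is controlled by Cauchy--Schwarz, since the annulus has finite measure.\<close>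

lemma recentre_bound:
  fixes c :: "int ^ 'n"
  obtains K where "K \<ge> 0"
    "\<And>g. sq_integrable rho g \<Longrightarrow>
       (LINT z|rho. (cmod (recentre n c g z))\<^sup>2) \<le> K * (LINT z|rho. (cmod (g z))\<^sup>2)"
proof -
  define N where "N g = (LINT z|rho. (cmod (g z))\<^sup>2)" for g :: "(real ^ 'n) \<times> real \<Rightarrow> complex"
  define \<phi> :: "(real ^ 'n) \<times> real \<Rightarrow> complex" where "\<phi> = bump c"
  define \<iota> :: "(real ^ 'n) \<times> real \<Rightarrow> complex" where "\<iota> z = indicator (annulus n c) z *\<^sub>R 1" for z
  have N_nonneg: "N g \<ge> 0" for g by (simp add: N_def)
  have \<phi>: "sq_integrable rho \<phi>" unfolding \<phi>_def by (rule sq_integrable_bump)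
  have \<iota>: "sq_integrable rho \<iota>"
    unfolding \<iota>_def by (intro sq_integrable_indicator annulus_sets annulus_finite)
  have sq: "integrable rho (\<lambda>z. (cmod (g z))\<^sup>2)" if "sq_integrable rho g" for g :: "(real ^ 'n) \<times> real \<Rightarrow> complex"
    using that by (simp add: sq_integrable_def)
  show ?thesis
  proof (rule that)
    show "2 + 2 * (N \<iota> * N \<phi>) \<ge> 0" using N_nonneg[of \<iota>] N_nonneg[of \<phi>] by simp
    fix g :: "(real ^ 'n) \<times> real \<Rightarrow> complex" assume g: "sq_integrable rho g"
    define I where "I = (LINT z|rho. indicator (annulus n c) z *\<^sub>R g z)"
    have "cmod I = cmod (LINT z|rho. \<iota> z * g z)"
      unfolding I_def by (simp add: \<iota>_def)
    also have "\<dots> \<le> (LINT z|rho. cmod (\<iota> z) * cmod (g z))"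
      using integral_norm_bound[of rho "\<lambda>z. \<iota> z * g z"] by (simp only: norm_mult)
    also have "\<dots> \<le> sqrt (N \<iota>) * sqrt (N g)"
      unfolding N_def by (rule integral_Cauchy_Schwarz[OF \<iota> g])
    finally have "(cmod I)\<^sup>2 \<le> (sqrt (N \<iota>) * sqrt (N g))\<^sup>2" by (rule power_mono) simp
    also have "\<dots> = N \<iota> * N g" using N_nonneg by (simp add: power_mult_distrib)
    finally have I: "(cmod I)\<^sup>2 \<le> N \<iota> * N g" .
    have "(LINT z|rho. (cmod (recentre n c g z))\<^sup>2)
        \<le> (LINT z|rho. 2 * (cmod (g z))\<^sup>2 + 2 * (cmod I)\<^sup>2 * (cmod (\<phi> z))\<^sup>2)"
    proof (rule integral_mono)
      show "integrable rho (\<lambda>z. (cmod (recentre n c g z))\<^sup>2)"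
        by (rule sq[OF sq_integrable_recentre[OF g]])
      show "integrable rho (\<lambda>z. 2 * (cmod (g z))\<^sup>2 + 2 * (cmod I)\<^sup>2 * (cmod (\<phi> z))\<^sup>2)"
        by (intro Bochner_Integration.integrable_add integrable_mult_right sq g \<phi>)
      fix z
      have "(cmod (recentre n c g z))\<^sup>2 = (cmod (indicator (annulus n c) z *\<^sub>R g z + - (I * \<phi> z)))\<^sup>2"
        by (simp add: recentre_def I_def \<phi>_def)
      also have "\<dots> \<le> 2 * (cmod (indicator (annulus n c) z *\<^sub>R g z))\<^sup>2 + 2 * (cmod (- (I * \<phi> z)))\<^sup>2"
        by (rule norm_add_sq_le)
      also have "\<dots> \<le> 2 * (cmod (g z))\<^sup>2 + 2 * (cmod I)\<^sup>2 * (cmod (\<phi> z))\<^sup>2"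
        by (simp add: indicator_def norm_mult power_mult_distrib)
      finally show "(cmod (recentre n c g z))\<^sup>2 \<le> 2 * (cmod (g z))\<^sup>2 + 2 * (cmod I)\<^sup>2 * (cmod (\<phi> z))\<^sup>2" .
    qed
    also have "\<dots> = 2 * N g + 2 * (cmod I)\<^sup>2 * N \<phi>"
      using sq[OF g] sq[OF \<phi>] by (simp add: N_def)
    also have "\<dots> \<le> 2 * N g + 2 * (N \<iota> * N g) * N \<phi>"
      using I N_nonneg[of \<phi>] by (intro add_left_mono mult_right_mono mult_left_mono) auto
    also have "\<dots> = (2 + 2 * (N \<iota> * N \<phi>)) * N g" by (simp add: algebra_simps)
    finally show "(LINT z|rho. (cmod (recentre n c g z))\<^sup>2) \<le> (2 + 2 * (N \<iota> * N \<phi>)) * (LINT z|rho. (cmod (g z))\<^sup>2)"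
      by (simp add: N_def)
  qed
qed

context dual_functional
begin

text \<open>The Riesz representation applies because recentring is bounded on \<open>L\<^sup>2\<close> and takes its values in the cancelling
  functions of a single tower, where \<open>l\<close> is controlled by the \<open>L\<^sup>2\<close> norm.\<close>

lemma recentre_representer:
  fixes w :: "(real ^ 'n) \<times> real"
  obtains F where "sq_integrable rho F"
    "\<And>g. sq_integrable rho g \<Longrightarrow> l (recentre n (corner w) g) = (LINT z|rho. F z * g z)"
proof -
  let ?c = "corner w" and ?R = "tower n (corner w)"
  obtain K where K: "K \<ge> 0" and rb: "\<And>g. sq_integrable rho g \<Longrightarrow>
       (LINT z|rho. (cmod (recentre n ?c g z))\<^sup>2) \<le> K * (LINT z|rho. (cmod (g z))\<^sup>2)"
    using recentre_bound[of n ?c] by blast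
  define D where "D = (H12_dual_norm l)\<^sup>2 * measure rho ?R"
  have D: "D \<ge> 0" by (simp add: D_def)
  show ?thesis
  proof (rule L2_Riesz_representation_complex[of rho "\<lambda>g. l (recentre n ?c g)" "D * K"])
    fix g h :: "(real ^ 'n) \<times> real \<Rightarrow> complex"
    assume g: "sq_integrable rho g" and h: "sq_integrable rho h"
    show "l (recentre n ?c (\<lambda>z. g z + h z)) = l (recentre n ?c g) + l (recentre n ?c h)"
      unfolding recentre_add[OF g h]
      by (rule l_add[OF cancelling_H12[OF tower_CZ recentre_cancelling[OF g]]
            cancelling_H12[OF tower_CZ recentre_cancelling[OF h]]])
  next
    fix a and g :: "(real ^ 'n) \<times> real \<Rightarrow> complex" assume g: "sq_integrable rho g"
    show "l (recentre n ?c (\<lambda>z. a * g z)) = a * l (recentre n ?c g)"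
      unfolding recentre_mult by (rule l_mult[OF cancelling_H12[OF tower_CZ recentre_cancelling[OF g]]])
  next
    fix g :: "(real ^ 'n) \<times> real \<Rightarrow> complex" assume g: "sq_integrable rho g"
    have "cmod (l (recentre n ?c g)) \<le> H12_dual_norm l * (sqrt (measure rho ?R) * L2_norm (recentre n ?c g))"
      by (rule l_cancelling_bound[OF tower_CZ recentre_cancelling[OF g]])
    then have "(cmod (l (recentre n ?c g)))\<^sup>2
        \<le> (H12_dual_norm l * (sqrt (measure rho ?R) * L2_norm (recentre n ?c g)))\<^sup>2"
      by (rule power_mono) simp
    also have "\<dots> = D * (LINT z|rho. (cmod (recentre n ?c g z))\<^sup>2)"
      by (simp add: D_def L2_norm_def power_mult_distrib)
    also have "\<dots> \<le> D * (K * (LINT z|rho. (cmod (g z))\<^sup>2))"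
      by (rule mult_left_mono[OF rb[OF g] D])
    finally show "(cmod (l (recentre n ?c g)))\<^sup>2 \<le> D * K * (LINT z|rho. (cmod (g z))\<^sup>2)"
      by (simp only: mult.assoc)
  next
    show "D * K \<ge> 0" using D K by simp
  qed (rule that)
qed

end

context dual_functional
begin

text \<open>A choice for every lattice vector \<open>c\<close>, square integrable in all cases, so that gluing needs no
  case distinction; the representing property is required only for the vectors that encode an orthant.\<close>

definition piece_representer :: "nat \<Rightarrow> int ^ 'n \<Rightarrow> (real ^ 'n) \<times> real \<Rightarrow> complex" where
  "piece_representer n c = (SOME F. sq_integrable rho F \<and>
     (c \<in> range corner \<longrightarrow> (\<forall>g. sq_integrable rho g \<longrightarrow> l (recentre n c g) = (LINT z|rho. F z * g z))))"

lemma piece_representer: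
  "sq_integrable rho (piece_representer n c)"
  "sq_integrable rho g \<Longrightarrow> l (recentre n (corner w) g) = (LINT z|rho. piece_representer n (corner w) z * g z)"
proof -
  have "\<exists>F. sq_integrable rho F \<and>
     (c \<in> range corner \<longrightarrow> (\<forall>g. sq_integrable rho g \<longrightarrow> l (recentre n c g) = (LINT z|rho. F z * g z)))" for c
  proof (cases "c \<in> range corner")
    case True
    then obtain w where w: "c = corner w" by blast
    obtain F where F: "sq_integrable rho F"
      "\<And>g. sq_integrable rho g \<Longrightarrow> l (recentre n (corner w) g) = (LINT z|rho. F z * g z)"
      using recentre_representer[of n w] by blast
    show ?thesis by (rule exI[of _ F]) (use F in \<open>simp add: w\<close>)
  next
    case False
    then show ?thesis by (intro exI[of _ "\<lambda>_. 0"]) (simp add: sq_integrable_def)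
  qed
  note * = someI_ex[OF this, folded piece_representer_def]
  show "sq_integrable rho (piece_representer n c)" using * by blast
  show "sq_integrable rho g \<Longrightarrow> l (recentre n (corner w) g) = (LINT z|rho. piece_representer n (corner w) z * g z)"
    using *[of "corner w"] by blast
qed

definition representer :: "(real ^ 'n) \<times> real \<Rightarrow> complex" where
  "representer z = piece_representer (LEAST n. z \<in> tower n (corner z)) (corner z) z"

lemma representer_measurable [measurable]: "representer \<in> borel_measurable rho"
  unfolding representer_def[abs_def]
  by (rule glue_measurable) (use piece_representer(1) in \<open>simp add: sq_integrable_def\<close>)

lemma representer_annulus:
  assumes "z \<in> annulus n (corner w)"
  shows "representer z = piece_representer n (corner w) z"
  unfolding representer_def annulus_eq(2)[OF assms] unfolding annulus_eq(1)[OF assms] ..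

text \<open>A compact set meets finitely many annuli, and on each of them \<open>representer\<close> is a square integrable function.\<close>

lemma representer_L2_loc: "representer \<in> L2_loc"
  unfolding L2_loc_def mem_Collect_eq
proof (intro conjI allI impI representer_measurable, elim conjE)
  fix K :: "((real ^ 'n) \<times> real) set" assume K: "compact K" "K \<subseteq> AxB"
  obtain N where N: "\<And>z. z \<in> K \<Longrightarrow> z \<in> tower N (corner z)"
    using compact_subset_towers[OF K] by blast
  let ?C = "range (corner :: (real ^ 'n) \<times> real \<Rightarrow> int ^ 'n)"
  let ?g = "\<lambda>z. \<Sum>n\<le>N. \<Sum>c\<in>?C. (cmod (piece_representer n c z))\<^sup>2"
  have [measurable]: "K \<in> sets rho" by (rule compact_sets_rho[OF K])
  show "set_integrable rho K (\<lambda>z. (cmod (representer z))\<^sup>2)"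
    unfolding set_integrable_def
  proof (rule Bochner_Integration.integrable_bound)
    show "integrable rho ?g"
      using piece_representer(1) by (intro Bochner_Integration.integrable_sum) (simp add: sq_integrable_def)
    show "(\<lambda>z. indicator K z *\<^sub>R (cmod (representer z))\<^sup>2) \<in> borel_measurable rho" by measurable
    have "(cmod (representer z))\<^sup>2 \<le> ?g z" if z: "z \<in> K" for z
    proof -
      define n where "n = (LEAST n. z \<in> tower n (corner z))"
      have "n \<le> N" unfolding n_def by (rule Least_le[of "\<lambda>n. z \<in> tower n (corner z)", OF N[OF z]])
      have "(cmod (representer z))\<^sup>2 = (cmod (piece_representer n (corner z) z))\<^sup>2"
        by (simp add: representer_def n_def)
      also have "\<dots> \<le> (\<Sum>c\<in>?C. (cmod (piece_representer n c z))\<^sup>2)"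
        by (rule member_le_sum) (simp_all add: finite_range_corner)
      also have "\<dots> \<le> ?g z"
        using \<open>n \<le> N\<close> by (intro member_le_sum[of n "{..N}"]) (auto intro: sum_nonneg)
      finally show ?thesis .
    qed
    moreover have "?g z \<ge> 0" for z by (intro sum_nonneg) simp
    ultimately have "norm (indicator K z *\<^sub>R (cmod (representer z))\<^sup>2) \<le> norm (?g z)" for z
      by (cases "z \<in> K") simp_all
    then show "AE z in rho. norm (indicator K z *\<^sub>R (cmod (representer z))\<^sup>2) \<le> norm (?g z)" by simp
  qed
qed

text \<open>Decompose \<open>g\<close> along the annuli of the tower. All recentred parts use the same bump, whose total coefficient
  is the integral of \<open>g\<close>, that is zero; so \<open>g\<close> is the sum of its recentred parts, and \<open>l\<close> is applied to each.\<close>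

lemma representer_tower:
  assumes g: "cancelling (tower N (corner w)) g"
  shows "l g = (LINT z|rho. representer z * g z)"
proof -
  let ?c = "corner w"
  let ?R = "tower N ?c"
  let ?g = "\<lambda>n z. indicator (annulus n ?c) z *\<^sub>R g z"
  have g2: "sq_integrable rho g" and supp: "AE z in rho. z \<notin> ?R \<longrightarrow> g z = 0"
    and g0: "(LINT z|rho. g z) = 0"
    using g by (auto simp: cancelling_def)
  have [measurable]: "g \<in> borel_measurable rho" using g2 by (simp add: sq_integrable_def)
  have gn2: "sq_integrable rho (?g n)" for n by (rule sq_integrable_restrict[OF g2 annulus_sets])
  have piece_eq: "(\<lambda>z. piece_representer n ?c z * ?g n z) = (\<lambda>z. representer z * ?g n z)" for n
  proof
    fix z
    show "piece_representer n ?c z * ?g n z = representer z * ?g n z"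
      by (cases "z \<in> annulus n ?c") (simp_all add: representer_annulus)
  qed
  have split: "(\<Sum>n<Suc N. ?g n z) = indicator ?R z *\<^sub>R g z" for z
    unfolding indicator_tower_eq_sum by (simp only: scaleR_sum_left)
  have restrict: "AE z in rho. indicator ?R z *\<^sub>R g z = g z"
    using supp by eventually_elim (auto simp: indicator_def)
  have "(\<Sum>n<Suc N. LINT z|rho. ?g n z) = (LINT z|rho. (\<Sum>n<Suc N. ?g n z))"
    by (rule Bochner_Integration.integral_sum[symmetric]) (rule integrable_annulus[OF g2])
  also have "\<dots> = (LINT z|rho. g z)"
    unfolding split by (rule integral_cong_AE) (use restrict in auto)
  finally have means: "(\<Sum>n<Suc N. LINT z|rho. ?g n z) = 0" using g0 by simp
  have "(\<Sum>n<Suc N. recentre n ?c g z) = indicator ?R z *\<^sub>R g z" for z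
  proof -
    have "(\<Sum>n<Suc N. recentre n ?c g z) = (\<Sum>n<Suc N. ?g n z) - (\<Sum>n<Suc N. LINT z|rho. ?g n z) * bump ?c z"
      by (simp only: recentre_def sum_subtractf sum_distrib_right)
    then show ?thesis by (simp only: split means) simp
  qed
  then have eq: "AE z in rho. g z = (\<Sum>n<Suc N. recentre n ?c g z)"
    using restrict by (simp only: eq_commute)
  have rc: "cancelling ?R (recentre n ?c g)" if "n < Suc N" for n
    by (rule cancelling_mono[OF recentre_cancelling[OF g2] tower_mono]) (use that in simp)
  \<comment> \<open>Levels beyond \<open>N\<close> are replaced by zero, because their annuli leave the tower.\<close>
  define r where "r n = (if n < Suc N then recentre n ?c g else (\<lambda>_. 0))" for n
  have r: "cancelling ?R (r n)" for n by (simp add: r_def rc cancelling_zero)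
  have r_sum: "(\<Sum>n<Suc N. recentre n ?c g z) = (\<Sum>n<Suc N. r n z)" for z
    by (rule sum.cong) (simp_all add: r_def)
  have "l g = l (\<lambda>z. \<Sum>n<Suc N. r n z)"
    using eq unfolding r_sum by (rule l_cong_AE[OF tower_CZ g cancelling_sum[OF tower_CZ r]])
  also have "\<dots> = (\<Sum>n<Suc N. l (r n))" by (rule l_sum[OF tower_CZ r])
  also have "\<dots> = (\<Sum>n<Suc N. LINT z|rho. representer z * ?g n z)"
  proof (rule sum.cong[OF refl])
    fix n assume "n \<in> {..<Suc N}"
    then have "l (r n) = l (recentre n ?c (?g n))" by (simp add: r_def recentre_restrict)
    also have "\<dots> = (LINT z|rho. piece_representer n ?c z * ?g n z)" by (rule piece_representer(2)[OF gn2])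
    also have "(\<lambda>z. piece_representer n ?c z * ?g n z) = (\<lambda>z. representer z * ?g n z)"
      by (rule piece_eq)
    finally show "l (r n) = (LINT z|rho. representer z * ?g n z)" .
  qed
  also have "\<dots> = (LINT z|rho. (\<Sum>n<Suc N. representer z * ?g n z))"
  proof (rule Bochner_Integration.integral_sum[symmetric])
    fix n
    have "integrable rho (\<lambda>z. piece_representer n ?c z * ?g n z)"
      by (rule sq_integrable_times[OF piece_representer(1) gn2])
    also have "(\<lambda>z. piece_representer n ?c z * ?g n z) = (\<lambda>z. representer z * ?g n z)"
      by (rule piece_eq)
    finally show "integrable rho (\<lambda>z. representer z * ?g n z)" .
  qed
  also have "\<dots> = (LINT z|rho. representer z * g z)"
    unfolding sum_distrib_left[symmetric] split
  proof (rule integral_cong_AE)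
    show "AE z in rho. representer z * (indicator ?R z *\<^sub>R g z) = representer z * g z"
      using restrict by eventually_elim (simp only:)
  qed measurable
  finally show ?thesis .
qed

lemma representer_cancelling:
  assumes R: "R \<in> CZ_sets" and g: "cancelling R g"
  shows "integrable rho (\<lambda>z. representer z * g z)" "l g = (LINT z|rho. representer z * g z)"
proof -
  obtain N w where "R \<subseteq> tower N (corner w)" by (rule CZ_subset_tower[OF R])
  with g have "cancelling (tower N (corner w)) g" by (rule cancelling_mono)
  then show "l g = (LINT z|rho. representer z * g z)" by (rule representer_tower)
  have [measurable]: "g \<in> borel_measurable rho" using g by (simp add: cancelling_def sq_integrable_def)
  have [measurable]: "R \<in> sets rho" by (rule CZ_sets_rho[OF R])
  have int: "integrable rho (\<lambda>z. (indicator R z *\<^sub>R representer z) * g z)"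
    using g by (intro sq_integrable_times L2_loc_CZ[OF representer_L2_loc R]) (simp add: cancelling_def)
  have "AE z in rho. z \<notin> R \<longrightarrow> g z = 0" using g by (simp add: cancelling_def)
  then have eq: "AE z in rho. (indicator R z *\<^sub>R representer z) * g z = representer z * g z"
    by eventually_elim (auto simp: indicator_def)
  show "integrable rho (\<lambda>z. representer z * g z)"
    by (rule integrable_cong_AE_imp[OF int _ eq]) measurable
qed

lemma representer_H12_fin:
  assumes "g \<in> H12_fin"
  shows "integrable rho (\<lambda>z. representer z * g z) \<and> l g = (LINT z|rho. representer z * g z)"
proof -
  obtain N :: nat and c b where g: "g = (\<lambda>z. \<Sum>j<N. c j * b j z)" and b: "\<forall>j<N. atom (b j)"
    using assms by (rule H12_finE)
  have "integrable rho (\<lambda>z. representer z * (\<Sum>j<N. c j * b j z)) \<and>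
      l (\<lambda>z. \<Sum>j<N. c j * b j z) = (LINT z|rho. representer z * (\<Sum>j<N. c j * b j z))"
    using b
  proof (induction N)
    case (Suc N)
    let ?S = "\<lambda>z. \<Sum>j<N. c j * b j z"
    have IH: "integrable rho (\<lambda>z. representer z * ?S z)" "l ?S = (LINT z|rho. representer z * ?S z)"
      using Suc by auto
    have "?S \<in> H12_fin" using Suc.prems by (intro H12_finI) simp
    then have S: "?S \<in> H12" by (rule subsetD[OF H12_fin_subset_H12])
    have bN: "atom (b N)" using Suc.prems by simp
    obtain R where R: "R \<in> CZ_sets" and bR: "cancelling R (b N)" by (rule atom_cancelling[OF bN])
    have cb: "cancelling R (\<lambda>z. c N * b N z)" by (rule cancelling_mult[OF bR])
    note dc = representer_cancelling[OF R cb]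
    have "l (\<lambda>z. ?S z + c N * b N z) = l ?S + l (\<lambda>z. c N * b N z)"
      by (rule l_add[OF S cancelling_H12[OF R cb]])
    also have "\<dots> = (LINT z|rho. representer z * ?S z + representer z * (c N * b N z))"
      unfolding IH(2) dc(2) by (rule Bochner_Integration.integral_add[OF IH(1) dc(1), symmetric])
    finally have "l (\<lambda>z. ?S z + c N * b N z) = (LINT z|rho. representer z * (?S z + c N * b N z))"
      by (simp only: distrib_left)
    moreover have "integrable rho (\<lambda>z. representer z * (?S z + c N * b N z))"
      unfolding distrib_left by (rule Bochner_Integration.integrable_add[OF IH(1) dc(1)])
    ultimately show ?case by (simp only: sum.lessThan_Suc)
  qed (simp add: l_zero)
  then show ?thesis by (simp only: g)
qed

text \<open>Testing against \<open>cnj u\<close>, where \<open>u\<close> is the deviation of the representer from its mean on \<open>R\<close>, gives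
  \<open>l (cnj u) = \<parallel>u\<parallel>\<^sub>2\<^sup>2\<close>, the mean being invisible to a cancelling function. The bound of \<open>l\<close> on
  cancelling functions then divides out one factor \<open>\<parallel>u\<parallel>\<^sub>2\<close>.\<close>

lemma representer_oscillation:
  assumes R: "R \<in> CZ_sets"
  shows "oscillation representer R \<le> H12_dual_norm l"
proof -
  define m where "m = measure rho R"
  define a where "a = mean_value representer R"
  define u where "u = (\<lambda>z. indicator R z *\<^sub>R (representer z - a))"
  have m: "m > 0" unfolding m_def by (rule CZ_pos[OF R])
  have [measurable]: "R \<in> sets rho" by (rule CZ_sets_rho[OF R])
  have u: "sq_integrable rho u" unfolding u_def by (rule sq_integrable_deviation[OF representer_L2_loc R])
  have [measurable]: "u \<in> borel_measurable rho" using u by (simp add: sq_integrable_def)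
  have dens: "integrable rho (\<lambda>z. indicator R z *\<^sub>R representer z)"
    by (rule integrable_of_support[OF L2_loc_CZ[OF representer_L2_loc R] CZ_sets_rho[OF R] CZ_finite[OF R]]) simp
  note const = integrable_indicator_scaleR[OF CZ_sets_rho[OF R] CZ_finite[OF R], of a]
  have "(LINT z|rho. u z) = (LINT z|rho. indicator R z *\<^sub>R representer z) - m *\<^sub>R a"
    using dens const by (simp add: u_def scaleR_diff_right m_def)
  also have "\<dots> = 0"
    using m by (simp add: a_def mean_value_def set_lebesgue_integral_def m_def scaleR_conv_of_real)
  finally have u0: "(LINT z|rho. u z) = 0" .
  have cu: "cancelling R (\<lambda>z. cnj (u z))"
    unfolding cancelling_def
  proof (intro conjI)
    have [measurable]: "cnj \<in> borel_measurable borel" by (intro borel_measurable_continuous_onI continuous_intros)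
    show "sq_integrable rho (\<lambda>z. cnj (u z))" by (rule sq_integrable_bound[OF u]) simp_all
    show "AE z in rho. z \<notin> R \<longrightarrow> cnj (u z) = 0" by (simp add: u_def)
    show "(LINT z|rho. cnj (u z)) = 0" using u0 by (simp add: integral_cnj)
  qed
  have cui: "integrable rho (\<lambda>z. cnj (u z))" by (rule cancelling_integrable[OF R cu])
  have sq: "integrable rho (\<lambda>z. complex_of_real ((cmod (u z))\<^sup>2))"
    using u by (intro integrable_of_real) (simp add: sq_integrable_def)
  have "l (\<lambda>z. cnj (u z)) = (LINT z|rho. representer z * cnj (u z))"
    by (rule representer_cancelling(2)[OF R cu])
  also have "\<dots> = (LINT z|rho. complex_of_real ((cmod (u z))\<^sup>2) + a * cnj (u z))"
  proof (rule Bochner_Integration.integral_cong[OF refl])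
    fix z
    have "representer z * cnj (u z) = u z * cnj (u z) + a * cnj (u z)"
      by (cases "z \<in> R") (simp_all add: u_def algebra_simps)
    then show "representer z * cnj (u z) = complex_of_real ((cmod (u z))\<^sup>2) + a * cnj (u z)"
      by (simp only: complex_norm_square)
  qed
  also have "\<dots> = complex_of_real (LINT z|rho. (cmod (u z))\<^sup>2)"
  proof -
    have "(LINT z|rho. complex_of_real ((cmod (u z))\<^sup>2) + a * cnj (u z))
        = (LINT z|rho. complex_of_real ((cmod (u z))\<^sup>2)) + a * (LINT z|rho. cnj (u z))"
      using Bochner_Integration.integral_add[OF sq integrable_mult_right[OF cui, of a]]
      by (simp only: Bochner_Integration.integral_mult_right_zero)
    then show ?thesis using cu by (simp only: cancelling_def integral_complex_of_real) simp
  qed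
  also have "\<dots> = complex_of_real ((L2_norm u)\<^sup>2)" by (simp add: L2_norm_def)
  finally have "cmod (l (\<lambda>z. cnj (u z))) = (L2_norm u)\<^sup>2" by (simp add: norm_power)
  moreover have "L2_norm (\<lambda>z. cnj (u z)) = L2_norm u" by (simp add: L2_norm_def)
  ultimately have le: "L2_norm u * L2_norm u \<le> (H12_dual_norm l * sqrt m) * L2_norm u"
    using l_cancelling_bound[OF R cu] by (simp add: m_def power2_eq_square mult.assoc)
  have "L2_norm u \<ge> 0" by (simp add: L2_norm_def)
  with le have "L2_norm u \<le> H12_dual_norm l * sqrt m"
    using dual_norm_nonneg m by (cases "L2_norm u = 0") (simp_all add: mult_le_cancel_right)
  then show ?thesis
    using m by (simp add: oscillation_eq u_def a_def m_def divide_le_eq)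
qed

lemma representer_BMO2: "representer \<in> BMO2" "BMO2_norm representer \<le> H12_dual_norm l"
proof -
  show "representer \<in> BMO2"
    unfolding BMO2_def mem_Collect_eq
    by (intro conjI representer_L2_loc bdd_aboveI2[of _ _ "H12_dual_norm l"] representer_oscillation)
  show "BMO2_norm representer \<le> H12_dual_norm l"
    unfolding BMO2_norm_def using tower_CZ[of 0 0] by (intro cSUP_least representer_oscillation) auto
qed

end

theorem theorem3p4:
  shows "(\<exists>C::real. \<forall>f \<in> (BMO2 :: ((real ^ 'n) \<times> real \<Rightarrow> complex) set).
            (\<forall>g\<in>H12_fin. integrable rho (\<lambda>z. f z * g z)) \<and>
            (\<exists>l\<in>H12_dual.
               (\<forall>g\<in>H12_fin. l g = (LINT z|rho. f z * g z)) \<and>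
               H12_dual_norm l \<le> C * BMO2_norm f)) \<and>
         (\<exists>C::real. \<forall>l \<in> (H12_dual :: (((real ^ 'n) \<times> real \<Rightarrow> complex) \<Rightarrow> complex) set).
            \<exists>f\<in>BMO2. BMO2_norm f \<le> C * H12_dual_norm l \<and>
               (\<forall>g\<in>H12_fin. integrable rho (\<lambda>z. f z * g z) \<and>
                  l g = (LINT z|rho. f z * g z)))"
proof (intro conjI exI[of _ 1] ballI)
  fix f g :: "(real ^ 'n) \<times> real \<Rightarrow> complex" assume "f \<in> BMO2" "g \<in> H12_fin"
  then show "integrable rho (\<lambda>z. f z * g z)" by (rule BMO2_pairing_integrable)
next
  fix f :: "(real ^ 'n) \<times> real \<Rightarrow> complex" assume "f \<in> BMO2"
  then obtain l :: "((real ^ 'n) \<times> real \<Rightarrow> complex) \<Rightarrow> complex" where "l \<in> H12_dual"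
    "\<And>g. g \<in> H12_fin \<Longrightarrow> l g = (LINT z|rho. f z * g z)" "H12_dual_norm l \<le> BMO2_norm f"
    by (rule BMO2_functional) blast
  then show "\<exists>l\<in>H12_dual. (\<forall>g\<in>H12_fin. l g = (LINT z|rho. f z * g z)) \<and>
      H12_dual_norm l \<le> 1 * BMO2_norm f"
    by (intro bexI[of _ l] conjI ballI) simp_all
next
  fix l :: "((real ^ 'n) \<times> real \<Rightarrow> complex) \<Rightarrow> complex" assume "l \<in> H12_dual"
  then interpret dual_functional l by unfold_locales
  show "\<exists>f\<in>BMO2. BMO2_norm f \<le> 1 * H12_dual_norm l \<and>
      (\<forall>g\<in>H12_fin. integrable rho (\<lambda>z. f z * g z) \<and> l g = (LINT z|rho. f z * g z))"
    using representer_BMO2 representer_H12_fin by (intro bexI[of _ representer] conjI) simp_all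
qed

end
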